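(* The following categories of spatial partitions on two levels are all subcategories of $P_2^{(2)}$ (the category of spatial partitions all of whose blocks have exactly two points), and they are all distinct: $$\langle\emptyset\rangle,\quad\langle h^{(2)}\rangle,\quad\langle \chi^{(2)}\rangle,\quad\langle d\rangle,\quad\langle c\rangle,\quad\langle c,d\rangle,\quad\langle a\rangle,\quad\langle c,a\rangle,\quad P_2^{(2)},$$ and the nine categories $\mathcal C_1\times\mathcal C_2$ with $\mathcal C_1,\mathcal C_2\in\{NC_2,\langle h\rangle,P_2\}$. Here: - $h\in P(3,3)$ has blocks $\{U_1,L_3\},\{U_2,L_2\},\{U_3,L_1\}$, and $h^{(2)}\in P^{(2)}(3,3)$ has blocks $\{U_{1,y},L_{3,y}\},\{U_{2,y},L_{2,y}\},\{U_{3,y},L_{1,y}\}$, $y=1,2$; - $\chi^{(2)}\in P^{(2)}(2,2)$ has blocks $\{U_{1,y},L_{2,y}\},\{U_{2,y},L_{1,y}\}$, $y=1,2$; - $d\in P^{(2)}(1,1)$ has blocks $\{U_{1,1},U_{1,2}\},\{L_{1,1},L_{1,2}\}$; - $c\in P^{(2)}(1,1)$ has blocks $\{U_{1,1},L_{1,2}\},\{U_{1,2},L_{1,1}\}$; - $a\in P^{(2)}(0,1)$ has the single block $\{L_{1,1},L_{1,2}\}$.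
   Context: $\mathbb N=\{1,2,\dots\}$, $\mathbb N_0=\mathbb N\cup\{0\}$. For $m\in\mathbb N$, $k,l\in\mathbb N_0$, $P^{(m)}(k,l)$ is the set of set partitions (into nonempty blocks) of the set of upper points $U_{x,y}$ ($1\le x\le k$, $1\le y\le m$) and lower points $L_{x,y}$ ($1\le x\le l$, $1\le y\le m$); $x$ is the column (counted from left to right in both rows), $y$ the level. $P^{(m)}=\bigcup_{k,l}P^{(m)}(k,l)$; for $m=1$ we write $P$, $U_x$, $L_x$. Operations: $p\otimes q$ is horizontal juxtaposition ($q$ to the right of $p$); for $q\in P^{(m)}(k,r)$, $p\in P^{(m)}(r,l)$ the composition $pq\in P^{(m)}(k,l)$ is obtained by identifying the lower points $L_{x,y}$ of $q$ with the upper points $U_{x,y}$ of $p$, joining blocks, and then deleting the middle points (and components consisting only of middle points); $p^*\in P^{(m)}(l,k)$ exchanges upper and lower points. A category of spatial partitions is a subset of $P^{(m)}$ closed under $\otimes$, composition and $^*$ and containing $|^{(m)}\in P^{(m)}(1,1)$ (blocks $\{U_{1,y},L_{1,y}\}$, $1\le y\le m$) and $\sqcap^{(m)}\in P^{(m)}(0,2)$ (blocks $\{L_{1,y},L_{2,y}\}$, $1\le y\le m$). $\langle p_1,\dots,p_r\rangle$ is the smallest category containing $p_1,\dots,p_r$; $\langle\emptyset\rangle$ is the smallest category of all (generated by $|^{(m)}$ and $\sqcap^{(m)}$ only). $P_2\subseteq P$ is the category of all partitions with all blocks of size two; $NC_2\subseteq P_2$ is the subset of noncrossing ones (drawable without crossings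 in the strip between the upper and the lower row). In the products $\mathcal C_1\times\mathcal C_2$, the category $\langle h\rangle\subseteq P$ is generated with $m=1$. For $\mathcal C_1,\mathcal C_2\subseteq P$, $\mathcal C_1\times\mathcal C_2\subseteq P^{(2)}$ is the set of all partitions in $P^{(2)}(k,l)$, $k,l\in\mathbb N_0$, obtained by placing some $p_1\in\mathcal C_1\cap P(k,l)$ on level 1 and some $p_2\in\mathcal C_2\cap P(k,l)$ on level 2, no block meeting both levels. *)

theory Defs
  imports "HOL-Library.Disjoint_Sets"
begin

text \<open>
  The first argument of a point is its column, the second its level, both counted from 1.
  Middle points occur only inside the definition of composition.
\<close>

datatype point = Up nat nat | is_mid: Mid nat nat | Lo nat nat

definition points :: "nat \<Rightarrow> nat \<Rightarrow> nat \<Rightarrow> point set" where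
  "points m k l = {Up x y | x y. x \<in> {1..k} \<and> y \<in> {1..m}} \<union> {Lo x y | x y. x \<in> {1..l} \<and> y \<in> {1..m}}"

definition parts :: "nat \<Rightarrow> nat \<Rightarrow> nat \<Rightarrow> point set set set" where
  "parts m k l = {p. partition_on (points m k l) p}"

text \<open>For \<open>m \<ge> 1\<close> the numbers \<open>k\<close> and \<open>l\<close> are determined by the partition, so this union is disjoint.\<close>

definition all_parts :: "nat \<Rightarrow> point set set set" where
  "all_parts m = (\<Union>k l. parts m k l)"

fun shift :: "nat \<Rightarrow> nat \<Rightarrow> point \<Rightarrow> point" where
  "shift k l (Up x y) = Up (k + x) y"
| "shift k l (Mid x y) = Mid x y"
| "shift k l (Lo x y) = Lo (l + x) y"

text \<open>The numbers \<open>k\<close> and \<open>l\<close> are those of the left factor: \<open>p \<in> parts m k l\<close>.\<close>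

definition tensor :: "nat \<Rightarrow> nat \<Rightarrow> point set set \<Rightarrow> point set set \<Rightarrow> point set set" where
  "tensor k l p q = p \<union> (\<lambda>B. shift k l ` B) ` q"

fun lower_to_mid :: "point \<Rightarrow> point" where
  "lower_to_mid (Lo x y) = Mid x y"
| "lower_to_mid s = s"

fun upper_to_mid :: "point \<Rightarrow> point" where
  "upper_to_mid (Up x y) = Mid x y"
| "upper_to_mid s = s"

definition glued_blocks :: "point set set \<Rightarrow> point set set \<Rightarrow> point set set" where
  "glued_blocks p q = (\<lambda>B. lower_to_mid ` B) ` q \<union> (\<lambda>B. upper_to_mid ` B) ` p"

text \<open>
  \<open>compose p q\<close> is the composition written \<open>pq\<close>, with \<open>q\<close> drawn above \<open>p\<close>. The classes of the
  transitive closure are the joined blocks; a component of middle points only becomes the empty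
  set, which is then removed.
\<close>

definition compose :: "point set set \<Rightarrow> point set set \<Rightarrow> point set set" where
  "compose p q =
    (let G = glued_blocks p q; R = (\<Union>B\<in>G. B \<times> B)\<^sup>+
     in (\<lambda>B. {s \<in> B. \<not> is_mid s}) ` (\<Union>G // R) - {{}})"

fun flip :: "point \<Rightarrow> point" where
  "flip (Up x y) = Lo x y"
| "flip (Mid x y) = Mid x y"
| "flip (Lo x y) = Up x y"

definition involution :: "point set set \<Rightarrow> point set set" where
  "involution p = (\<lambda>B. flip ` B) ` p"

definition id_part :: "nat \<Rightarrow> point set set" where
  "id_part m = {{Up 1 y, Lo 1 y} | y. y \<in> {1..m}}"

definition pair_part :: "nat \<Rightarrow> point set set" where
  "pair_part m = {{Lo 1 y, Lo 2 y} | y. y \<in> {1..m}}"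

definition category :: "nat \<Rightarrow> point set set set \<Rightarrow> bool" where
  "category m C \<longleftrightarrow>
     C \<subseteq> all_parts m \<and>
     id_part m \<in> C \<and>
     pair_part m \<in> C \<and>
     (\<forall>k l k' l'. \<forall>p \<in> C \<inter> parts m k l. \<forall>q \<in> C \<inter> parts m k' l'. tensor k l p q \<in> C) \<and>
     (\<forall>k r l. \<forall>q \<in> C \<inter> parts m k r. \<forall>p \<in> C \<inter> parts m r l. compose p q \<in> C) \<and>
     (\<forall>p \<in> C. involution p \<in> C)"

definition generated :: "nat \<Rightarrow> point set set set \<Rightarrow> point set set set" where
  "generated m S = \<Inter> {C. category m C \<and> S \<subseteq> C}"

definition pairings :: "nat \<Rightarrow> point set set set" where
  "pairings m = {p \<in> all_parts m. \<forall>B \<in> p. card B = 2}"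

text \<open>
  The order in which the points of a one-level partition are met when walking around the boundary
  of the strip: \<open>Up 1 1, \<dots>, Up k 1, Lo l 1, \<dots>, Lo 1 1\<close>. A partition can be drawn in the strip
  without crossings iff no two distinct blocks alternate in this order.
\<close>

fun before :: "point \<Rightarrow> point \<Rightarrow> bool" where
  "before (Up x _) (Up x' _) \<longleftrightarrow> x < x'"
| "before (Up _ _) (Lo _ _) \<longleftrightarrow> True"
| "before (Lo x _) (Lo x' _) \<longleftrightarrow> x > x'"
| "before _ _ \<longleftrightarrow> False"

definition noncrossing :: "point set set \<Rightarrow> bool" where
  "noncrossing p \<longleftrightarrow>
     \<not> (\<exists>A \<in> p. \<exists>B \<in> p. A \<noteq> B \<and>
         (\<exists>s \<in> A. \<exists>t \<in> B. \<exists>s' \<in> A. \<exists>t' \<in> B. before s t \<and> before t s' \<and> before s' t'))"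

definition nc_pairings :: "point set set set" where
  "nc_pairings = {p \<in> pairings 1. noncrossing p}"

fun to_level :: "nat \<Rightarrow> point \<Rightarrow> point" where
  "to_level y (Up x _) = Up x y"
| "to_level y (Mid x _) = Mid x y"
| "to_level y (Lo x _) = Lo x y"

definition two_level_product ::
    "point set set set \<Rightarrow> point set set set \<Rightarrow> point set set set" where
  "two_level_product C1 C2 =
     {(\<lambda>B. to_level 1 ` B) ` p1 \<union> (\<lambda>B. to_level 2 ` B) ` p2 | p1 p2 k l.
        p1 \<in> C1 \<inter> parts 1 k l \<and> p2 \<in> C2 \<inter> parts 1 k l}"

definition h_part :: "nat \<Rightarrow> point set set" where
  "h_part m = (\<Union>y\<in>{1..m}. {{Up 1 y, Lo 3 y}, {Up 2 y, Lo 2 y}, {Up 3 y, Lo 1 y}})"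

definition chi_part :: "nat \<Rightarrow> point set set" where
  "chi_part m = (\<Union>y\<in>{1..m}. {{Up 1 y, Lo 2 y}, {Up 2 y, Lo 1 y}})"

definition d_part :: "point set set" where
  "d_part = {{Up 1 1, Up 1 2}, {Lo 1 1, Lo 1 2}}"

definition c_part :: "point set set" where
  "c_part = {{Up 1 1, Lo 1 2}, {Up 1 2, Lo 1 1}}"

definition a_part :: "point set set" where
  "a_part = {{Lo 1 1, Lo 1 2}}"

end

theory Submission
  imports Defs
begin

text \<open>
  Let \<open>\<phi>\<close> send the colours of a column to an involution. Call a partition balanced if, for every
  colouring of its points that is constant on blocks, the product of the \<open>\<phi>\<close>-values of the upper
  columns equals that of the lower columns. A colouring of a composition extends to the middle
  points, so the balanced partitions form a category for every \<open>\<phi>\<close>, and most inequalities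
  of categories are witnessed by one partition and one \<open>\<phi>\<close> with values in the isometries of the line.
  The noncrossing pairings are the pairings that are balanced for a suitable \<open>\<phi>\<close>, hence a category.
  That pairings are closed under composition is a count of edges in connected graphs.
\<close>

section \<open>Categories of partitions\<close>

text \<open>Composing noncrossing pairings is where a picture is hard to turn into a proof: a string
  may run back and forth through the middle row. Balance avoids following it. Along the boundary of
  a noncrossing pairing equal involutions cancel in nested pairs, while a crossing leaves a word
  \<open>a b a b\<close>, which is nontrivial for two different reflections of a line. The
  separating choices of \<open>\<phi>\<close> come from relations between involutions. Commuting
  signs do not see permutations of columns, so they detect what happens between the levels.
  Reflections satisfy \<open>a b c = c b a\<close> without commuting, which is the relation of
  \<open>h\<close>; admitting the identity as a further value destroys it. Products call for other
  arguments: a block meeting both levels excludes \<open>a\<close>, \<open>c\<close>,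
  \<open>d\<close> from each of them, and their factors can be recovered. Comparing eighteen
  categories in pairs would take 153 inequalities; instead a number is read off from a few
  memberships and takes eighteen different values.\<close>

lemma points_simps [simp]:
  "Up x y \<in> points m k l \<longleftrightarrow> x \<in> {1..k} \<and> y \<in> {1..m}"
  "Lo x y \<in> points m k l \<longleftrightarrow> x \<in> {1..l} \<and> y \<in> {1..m}"
  "Mid x y \<notin> points m k l"
  by (auto simp: points_def)

lemma finite_points [simp]: "finite (points m k l)"
proof -
  have "points m k l = (\<lambda>(x, y). Up x y) ` ({1..k} \<times> {1..m}) \<union> (\<lambda>(x, y). Lo x y) ` ({1..l} \<times> {1..m})"
    by (auto simp: points_def)
  then show ?thesis by simp
qed

lemma points_inject:
  assumes "m \<ge> 1" "points m k l = points m k' l'"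
  shows "k = k'" "l = l'"
proof -
  have "{1..k} = {x. Up x 1 \<in> points m k l}" "{1..l} = {x. Lo x 1 \<in> points m k l}" for k l
    using assms(1) by auto
  then have "{1..k} = {1..k'}" "{1..l} = {1..l'}" using assms(2) by metis+
  then show "k = k'" "l = l'" by (metis card_atLeastAtMost diff_Suc_1)+
qed

lemma partsD: "p \<in> parts m k l \<Longrightarrow> \<Union>p = points m k l"
  by (auto simp: parts_def partition_on_def)

lemma parts_inject:
  assumes "m \<ge> 1" "p \<in> parts m k l" "p \<in> parts m k' l'"
  shows "k = k'" "l = l'"
proof -
  have "points m k l = points m k' l'" using partsD[OF assms(2)] partsD[OF assms(3)] by simp
  from points_inject[OF assms(1) this] show "k = k'" "l = l'" .
qed

lemma parts_nonempty: "p \<in> parts m k l \<Longrightarrow> {} \<notin> p"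
  by (auto simp: parts_def partition_on_def)

lemma partition_on_inj_image':
  assumes "partition_on A P" "inj_on f A"
  shows "partition_on (f ` A) ((`) f ` P)"
  using partition_on_inj_image[OF assms] partition_onD3[OF assms(1)] by (simp add: image_iff)

lemma partition_on_Un:
  assumes "partition_on A P" "partition_on B Q" "A \<inter> B = {}"
  shows "partition_on (A \<union> B) (P \<union> Q)"
proof -
  have "disjoint (P \<union> Q)"
    using assms by (intro disjoint_union) (simp_all add: partition_on_def)
  then show ?thesis using assms(1,2) by (simp add: partition_on_def)
qed

lemma partsI:
  assumes "\<Union>p = points m k l" "disjoint p" "{} \<notin> p"
  shows "p \<in> parts m k l"
  using assms by (auto simp: parts_def partition_on_def)

text \<open>The predicate sees \<open>k\<close> and \<open>l\<close> because balance depends on the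
  numbers of columns. For \<open>m \<ge> 1\<close> they can be read off from the partition, so
  membership is the predicate itself (\<open>family_iff\<close>); for \<open>m = 0\<close> the empty
  partition would have every \<open>k\<close> and \<open>l\<close>.\<close>

definition family :: "nat \<Rightarrow> (nat \<Rightarrow> nat \<Rightarrow> point set set \<Rightarrow> bool) \<Rightarrow> point set set set" where
  "family m P = {p. \<exists>k l. p \<in> parts m k l \<and> P k l p}"

lemma family_iff:
  assumes "m \<ge> 1" "p \<in> parts m k l"
  shows "p \<in> family m P \<longleftrightarrow> P k l p"
  unfolding family_def using assms(2) parts_inject[OF assms] by blast

lemma inj_shift: "inj (shift k l)"
proof (rule injI)
  fix s t show "shift k l s = shift k l t \<Longrightarrow> s = t"
    by (cases s; cases t) auto
qed

lemma flip_flip [simp]: "flip (flip s) = s"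
  by (cases s) auto

lemma inj_flip: "inj flip"
  by (rule inj_on_inverseI[of _ flip]) simp

lemma points_shift: "points m (k + k') (l + l') = points m k l \<union> shift k l ` points m k' l'" (is "?A = ?B")
proof (rule set_eqI)
  fix s
  have up: "Up x y \<in> shift k l ` points m k' l' \<longleftrightarrow> (x > k \<and> x \<le> k + k' \<and> y \<in> {1..m})" for x y
  proof
    assume "x > k \<and> x \<le> k + k' \<and> y \<in> {1..m}"
    then show "Up x y \<in> shift k l ` points m k' l'"
      by (intro image_eqI[of _ _ "Up (x - k) y"]) auto
  next
    assume "Up x y \<in> shift k l ` points m k' l'"
    then obtain t where "t \<in> points m k' l'" "Up x y = shift k l t" by blast
    then show "x > k \<and> x \<le> k + k' \<and> y \<in> {1..m}" by (cases t) auto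
  qed
  have lo: "Lo x y \<in> shift k l ` points m k' l' \<longleftrightarrow> (x > l \<and> x \<le> l + l' \<and> y \<in> {1..m})" for x y
  proof
    assume "x > l \<and> x \<le> l + l' \<and> y \<in> {1..m}"
    then show "Lo x y \<in> shift k l ` points m k' l'"
      by (intro image_eqI[of _ _ "Lo (x - l) y"]) auto
  next
    assume "Lo x y \<in> shift k l ` points m k' l'"
    then obtain t where "t \<in> points m k' l'" "Lo x y = shift k l t" by blast
    then show "x > l \<and> x \<le> l + l' \<and> y \<in> {1..m}" by (cases t) auto
  qed
  have mid: "Mid x y \<notin> shift k l ` points m k' l'" for x y
  proof
    assume "Mid x y \<in> shift k l ` points m k' l'"
    then obtain t where "t \<in> points m k' l'" "Mid x y = shift k l t" by blast
    then show False by (cases t) auto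
  qed
  show "s \<in> ?A \<longleftrightarrow> s \<in> ?B"
    by (cases s) (auto simp: up lo mid)
qed

lemma tensor_parts:
  assumes "p \<in> parts m k l" "q \<in> parts m k' l'"
  shows "tensor k l p q \<in> parts m (k + k') (l + l')"
proof -
  have disj: "points m k l \<inter> shift k l ` points m k' l' = {}"
  proof -
    have "shift k l t \<notin> points m k l" if "t \<in> points m k' l'" for t
      using that by (cases t) auto
    then show ?thesis by blast
  qed
  show ?thesis
    using assms unfolding parts_def tensor_def points_shift
    by (auto intro!: partition_on_Un partition_on_inj_image' inj_on_subset[OF inj_shift] disj)
qed

lemma flip_points: "flip ` points m k l = points m l k"
proof -
  have "flip s \<in> points m l k \<longleftrightarrow> s \<in> points m k l" for s k l by (cases s) auto
  then show ?thesis by (auto simp: image_iff) (metis flip_flip)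
qed

lemma involution_parts: "p \<in> parts m k l \<Longrightarrow> involution p \<in> parts m l k"
  using partition_on_inj_image'[of "points m k l" p flip] inj_on_subset[OF inj_flip]
  by (auto simp: parts_def involution_def flip_points)

section \<open>Composition as a quotient by the gluing relation\<close>

definition joined :: "'a set set \<Rightarrow> ('a \<times> 'a) set" where
  "joined G = (\<Union>B\<in>G. B \<times> B)\<^sup>+"

lemma joined_sub: "joined G \<subseteq> \<Union>G \<times> \<Union>G"
  unfolding joined_def by (rule trancl_subset_Sigma) auto

text \<open>Each \<open>B \<times> B\<close> is symmetric and contains the diagonal of
  \<open>B\<close>, so the transitive closure alone is already reflexive on
  \<open>\<Union>G\<close>.\<close>

lemma equiv_joined: "equiv (\<Union>G) (joined G)"
proof (rule equivI)
  show "joined G \<subseteq> \<Union>G \<times> \<Union>G" by (rule joined_sub)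
  show "refl_on (\<Union>G) (joined G)"
    by (auto simp: refl_on_def joined_def)
  show "sym (joined G)"
    unfolding joined_def by (rule sym_trancl) (auto simp: sym_def)
  show "trans (joined G)" by (simp add: joined_def)
qed

lemma joined_block: "B \<in> G \<Longrightarrow> s \<in> B \<Longrightarrow> t \<in> B \<Longrightarrow> (s, t) \<in> joined G"
  unfolding joined_def by (rule r_into_trancl) blast

lemma compose_eq:
  "compose p q = (\<lambda>B. {s \<in> B. \<not> is_mid s}) ` (\<Union>(glued_blocks p q) // joined (glued_blocks p q)) - {{}}"
  by (simp add: compose_def joined_def Let_def)

lemma Union_glued:
  assumes "q \<in> parts m k r" "p \<in> parts m r l"
  shows "\<Union>(glued_blocks p q) = points m k l \<union> (\<lambda>(x, y). Mid x y) ` ({1..r} \<times> {1..m})"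
proof -
  have "\<Union>(glued_blocks p q) = lower_to_mid ` (\<Union>q) \<union> upper_to_mid ` (\<Union>p)"
    by (auto simp: glued_blocks_def)
  also have "\<dots> = points m k l \<union> (\<lambda>(x, y). Mid x y) ` ({1..r} \<times> {1..m})" (is "?L = ?R")
  proof
    have "lower_to_mid s \<in> ?R" if "s \<in> points m k r" for s using that by (cases s) auto
    moreover have "upper_to_mid s \<in> ?R" if "s \<in> points m r l" for s using that by (cases s) auto
    ultimately show "?L \<subseteq> ?R" using partsD[OF assms(1)] partsD[OF assms(2)] by auto
    have "s \<in> lower_to_mid ` points m k r \<union> upper_to_mid ` points m r l" if "s \<in> ?R" for s
    proof (cases s)
      case (Up x y)
      then show ?thesis using that by (intro UnI1 image_eqI[of _ _ s]) auto
    next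
      case (Mid x y)
      then show ?thesis using that by (intro UnI1 image_eqI[of _ _ "Lo x y"]) auto
    next
      case (Lo x y)
      then show ?thesis using that by (intro UnI2 image_eqI[of _ _ s]) auto
    qed
    then show "?R \<subseteq> ?L" using partsD[OF assms(1)] partsD[OF assms(2)] by auto
  qed
  finally show ?thesis .
qed

text \<open>Deleting the middle points restricts a partition to a subset: the traces of the classes,
  without the empty one, again form a partition.\<close>

lemma compose_parts:
  assumes "q \<in> parts m k r" "p \<in> parts m r l"
  shows "compose p q \<in> parts m k l"
proof -
  let ?G = "glued_blocks p q"
  have "partition_on (\<Union>?G) (\<Union>?G // joined ?G)"
    by (rule partition_on_quotient[OF equiv_joined])
  from partition_on_restrict[OF this, of "{s. \<not> is_mid s}"]
  have "partition_on ({s. \<not> is_mid s} \<inter> \<Union>?G) ((\<inter>) {s. \<not> is_mid s} ` (\<Union>?G // joined ?G) - {{}})" .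
  moreover have "{s. \<not> is_mid s} \<inter> \<Union>?G = points m k l"
  proof -
    have "\<not> is_mid s" if "s \<in> points m k l" for s using that by (cases s) auto
    then show ?thesis unfolding Union_glued[OF assms] by auto
  qed
  moreover have "(\<inter>) {s. \<not> is_mid s} = (\<lambda>B. {s \<in> B. \<not> is_mid s})" by auto
  ultimately show ?thesis by (simp add: parts_def compose_eq)
qed

lemma id_part_parts: "id_part m \<in> parts m 1 1"
  by (rule partsI) (auto simp: id_part_def points_def disjoint_def)

lemma pair_part_parts: "pair_part m \<in> parts m 0 2"
proof (rule partsI)
  have "\<Union>(pair_part m) = (\<Union>y\<in>{1..m}. {Lo 1 y, Lo 2 y})"
    unfolding pair_part_def by blast
  also have "\<dots> = points m 0 2"
  proof (rule set_eqI)
    fix s show "s \<in> (\<Union>y\<in>{1..m}. {Lo 1 y, Lo 2 y}) \<longleftrightarrow> s \<in> points m 0 2"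
      by (cases s) (auto simp: le_Suc_eq numeral_2_eq_2)
  qed
  finally show "\<Union>(pair_part m) = points m 0 2" .
qed (auto simp: pair_part_def disjoint_def)

lemma category_family:
  assumes "m \<ge> 1"
    and "P 1 1 (id_part m)" "P 0 2 (pair_part m)"
    and "\<And>k l k' l' p q. p \<in> parts m k l \<Longrightarrow> q \<in> parts m k' l' \<Longrightarrow> P k l p \<Longrightarrow> P k' l' q
           \<Longrightarrow> P (k + k') (l + l') (tensor k l p q)"
    and "\<And>k r l p q. q \<in> parts m k r \<Longrightarrow> p \<in> parts m r l \<Longrightarrow> P k r q \<Longrightarrow> P r l p
           \<Longrightarrow> P k l (compose p q)"
    and "\<And>k l p. p \<in> parts m k l \<Longrightarrow> P k l p \<Longrightarrow> P l k (involution p)"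
  shows "category m (family m P)"
  unfolding category_def
proof (intro conjI allI ballI)
  show "family m P \<subseteq> all_parts m" by (auto simp: family_def all_parts_def)
  show "id_part m \<in> family m P" "pair_part m \<in> family m P"
    using assms(2,3) id_part_parts[of m] pair_part_parts[of m] unfolding family_def by blast+
  show "involution p \<in> family m P" if "p \<in> family m P" for p
  proof -
    from that obtain k l where "p \<in> parts m k l" "P k l p" by (auto simp: family_def)
    then show ?thesis using involution_parts[of p m k l] assms(6)[of p k l] unfolding family_def by blast
  qed
  fix k l k' l' p q
  assume "p \<in> family m P \<inter> parts m k l" "q \<in> family m P \<inter> parts m k' l'"
  then have *: "p \<in> parts m k l" "q \<in> parts m k' l'" "P k l p" "P k' l' q"
    using family_iff[OF assms(1)] by blast+
  show "tensor k l p q \<in> family m P"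
    using assms(4)[OF *] family_iff[OF assms(1) tensor_parts[OF *(1,2)]] by blast
next
  fix k r l p q
  assume "q \<in> family m P \<inter> parts m k r" "p \<in> family m P \<inter> parts m r l"
  then have *: "q \<in> parts m k r" "p \<in> parts m r l" "P k r q" "P r l p"
    using family_iff[OF assms(1)] by blast+
  show "compose p q \<in> family m P"
    using assms(5)[OF *] family_iff[OF assms(1) compose_parts[OF *(1,2)]] by blast
qed

section \<open>Generated categories\<close>

lemma category_all_parts:
  assumes "m \<ge> 1" shows "category m (all_parts m)"
proof -
  have "all_parts m = family m (\<lambda>_ _ _. True)" by (auto simp: all_parts_def family_def)
  then show ?thesis using category_family[OF assms, of "\<lambda>_ _ _. True"] by simp
qed

lemma generated_subset: "category m C \<Longrightarrow> S \<subseteq> C \<Longrightarrow> generated m S \<subseteq> C"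
  by (auto simp: generated_def)

lemma generated_superset: "S \<subseteq> generated m S"
  by (auto simp: generated_def)

lemma categoryD:
  assumes "category m C"
  shows "C \<subseteq> all_parts m" "id_part m \<in> C" "pair_part m \<in> C"
    "\<And>k l k' l' p q. p \<in> C \<Longrightarrow> p \<in> parts m k l \<Longrightarrow> q \<in> C \<Longrightarrow> q \<in> parts m k' l' \<Longrightarrow> tensor k l p q \<in> C"
    "\<And>k r l p q. q \<in> C \<Longrightarrow> q \<in> parts m k r \<Longrightarrow> p \<in> C \<Longrightarrow> p \<in> parts m r l \<Longrightarrow> compose p q \<in> C"
    "\<And>p. p \<in> C \<Longrightarrow> involution p \<in> C"
  using assms unfolding category_def by blast+

text \<open>An intersection over no category at all would be the universal set;
  \<open>all_parts m\<close> is a category containing \<open>S\<close>, so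
  \<open>generated m S\<close> stays inside it. Each closure property then passes to the
  intersection.\<close>

lemma category_generated:
  assumes "m \<ge> 1" "S \<subseteq> all_parts m"
  shows "category m (generated m S)"
proof -
  have "generated m S \<subseteq> all_parts m"
    by (rule generated_subset[OF category_all_parts[OF assms(1)] assms(2)])
  then show ?thesis
    unfolding category_def
  proof (intro conjI allI ballI)
    show "id_part m \<in> generated m S" "pair_part m \<in> generated m S"
      by (auto simp: generated_def categoryD)
    show "involution p \<in> generated m S" if "p \<in> generated m S" for p
      using that by (auto simp: generated_def categoryD(6))
    fix k l k' l' p q
    assume "p \<in> generated m S \<inter> parts m k l" "q \<in> generated m S \<inter> parts m k' l'"
    then show "tensor k l p q \<in> generated m S"
      by (auto simp: generated_def intro: categoryD(4))
  next
    fix k r l p q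
    assume "q \<in> generated m S \<inter> parts m k r" "p \<in> generated m S \<inter> parts m r l"
    then show "compose p q \<in> generated m S"
      by (auto simp: generated_def intro: categoryD(5))
  qed
qed

section \<open>Pairings\<close>

lemma joined_class_absorbs:
  assumes "C \<in> \<Union>G // joined G" "B \<in> G" "s \<in> B" "s \<in> C"
  shows "B \<subseteq> C"
proof
  fix t assume "t \<in> B"
  from assms(1) obtain x where C: "C = joined G `` {x}" by (auto simp: quotient_def)
  have "(x, s) \<in> joined G" using assms(4) C by simp
  moreover have "(s, t) \<in> joined G" using joined_block[OF assms(2,3) \<open>t \<in> B\<close>] .
  ultimately have "(x, t) \<in> joined G" unfolding joined_def by (rule trancl_trans)
  then show "t \<in> C" using C by simp
qed

text \<open>A connected graph with \<open>n\<close> edges has at most \<open>n + 1\<close> vertices.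
  In place of a spanning tree, take a maximal part \<open>S\<close> of the class that contains
  \<open>x\<close> and satisfies the bound: a pair leaving \<open>S\<close> would bring one new
  point and at least one new pair, so \<open>S\<close> is closed under joining and is the whole
  class.\<close>

lemma card_joined_class:
  assumes "finite G" "\<And>B. B \<in> G \<Longrightarrow> card B = 2" "C \<in> \<Union>G // joined G"
  shows "card C \<le> card {B \<in> G. B \<subseteq> C} + 1"
proof -
  have "finite B" if "B \<in> G" for B using assms(2)[OF that] card.infinite by fastforce
  then have finG: "finite (\<Union>G)" using assms(1) by blast
  from assms(3) obtain x where x: "x \<in> \<Union>G" and C: "C = joined G `` {x}"
    by (auto simp: quotient_def)
  have "C \<subseteq> \<Union>G" using C joined_sub[of G] by blast
  then have finC: "finite C" using finG by (rule finite_subset)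
  define P where "P = {S. x \<in> S \<and> S \<subseteq> C \<and> card S \<le> card {B \<in> G. B \<subseteq> S} + 1}"
  have "finite P" unfolding P_def using finC by (auto intro: finite_subset[of _ "Pow C"])
  moreover have "{x} \<in> P" using x C by (auto simp: P_def intro: joined_block)
  ultimately obtain S where S: "S \<in> P" and max: "\<And>S'. S' \<in> P \<Longrightarrow> S \<subseteq> S' \<Longrightarrow> S = S'"
    using finite_has_maximal[of P] by blast
  have closed: "t \<in> S" if B: "B \<in> G" "s \<in> B" "t \<in> B" and s: "s \<in> S" for B s t
  proof (rule ccontr)
    assume t: "t \<notin> S"
    obtain u v where "B = {u, v}" using assms(2)[OF B(1)] card_2_iff by metis
    then have Bst: "B = {s, t}" using B s t by auto
    have "B \<subseteq> C" using joined_class_absorbs[OF assms(3) B(1,2)] s S by (auto simp: P_def)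
    then have sub: "insert t S \<subseteq> C" using S B(3) by (auto simp: P_def)
    have finS: "finite S" using sub finC by (meson finite_subset subset_insertI subset_trans)
    \<comment> \<open>\<open>B\<close> lies inside \<open>insert t S\<close> but not inside
      \<open>S\<close>, so the new point is paid for by a new pair.\<close>
    have "insert B {B \<in> G. B \<subseteq> S} \<subseteq> {B \<in> G. B \<subseteq> insert t S}" using B(1) Bst s by auto
    then have "card (insert B {B \<in> G. B \<subseteq> S}) \<le> card {B \<in> G. B \<subseteq> insert t S}"
      using assms(1) by (intro card_mono) auto
    moreover have "B \<notin> {B \<in> G. B \<subseteq> S}" using B(3) t by auto
    ultimately have "card {B \<in> G. B \<subseteq> S} + 1 \<le> card {B \<in> G. B \<subseteq> insert t S}"
      using assms(1) by simp
    moreover have "card (insert t S) = card S + 1" using t finS by simp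
    ultimately have "insert t S \<in> P" using S sub by (auto simp: P_def)
    then show False using max[of "insert t S"] t by auto
  qed
  have "t \<in> S" if "(x, t) \<in> joined G" for t
    using that unfolding joined_def
  proof (induction rule: trancl_induct)
    case (base t)
    then show ?case using closed S by (auto simp: P_def)
  next
    case (step s t)
    then show ?case using closed by auto
  qed
  then have "S = C" using S C by (auto simp: P_def)
  then show ?thesis using S by (simp add: P_def)
qed

text \<open>\<open>H\<close> stands for one of the two layers of glued pairs, from \<open>q\<close>
  or from \<open>p\<close>, and \<open>X\<close> for its support. A class contains every pair that
  it meets, so its trace on \<open>X\<close> is a disjoint union of pairs.\<close>

lemma card_class_Int:
  assumes "partition_on X H" "H \<subseteq> G" "finite X" "\<And>B. B \<in> H \<Longrightarrow> card B = 2"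
    and "C \<in> \<Union>G // joined G"
  shows "card (C \<inter> X) = 2 * card {B \<in> H. B \<subseteq> C}"
proof -
  have "C \<inter> X = \<Union>{B \<in> H. B \<subseteq> C}"
  proof -
    have "s \<in> \<Union>{B \<in> H. B \<subseteq> C}" if s: "s \<in> C" "s \<in> X" for s
    proof -
      obtain B where "B \<in> H" "s \<in> B" using partition_onD1[OF assms(1)] s(2) by blast
      then show ?thesis using joined_class_absorbs[OF assms(5) _ _ s(1), of B] assms(2) by blast
    qed
    then show ?thesis using partition_onD1[OF assms(1)] by blast
  qed
  also have "card \<dots> = (\<Sum>B\<in>{B \<in> H. B \<subseteq> C}. card B)"
  proof (rule card_Union_disjoint)
    show "pairwise disjnt {B \<in> H. B \<subseteq> C}"
      using partition_onD2[OF assms(1)] by (auto simp: pairwise_def disjoint_def disjnt_def)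
    show "finite B" if "B \<in> {B \<in> H. B \<subseteq> C}" for B
      using that partition_onD1[OF assms(1)] assms(3) by (auto intro: finite_subset[of B X])
  qed
  also have "\<dots> = (\<Sum>B\<in>{B \<in> H. B \<subseteq> C}. 2)" using assms(4) by (intro sum.cong) auto
  finally show ?thesis by simp
qed

lemma inj_on_lower_to_mid: "inj_on lower_to_mid (points m k l)"
proof (rule inj_onI)
  fix s t assume "s \<in> points m k l" "t \<in> points m k l" "lower_to_mid s = lower_to_mid t"
  then show "s = t" by (cases s; cases t) auto
qed

lemma inj_on_upper_to_mid: "inj_on upper_to_mid (points m k l)"
proof (rule inj_onI)
  fix s t assume "s \<in> points m k l" "t \<in> points m k l" "upper_to_mid s = upper_to_mid t"
  then show "s = t" by (cases s; cases t) auto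
qed

lemma Mid_image:
  "Mid x y \<in> lower_to_mid ` points m k l \<longleftrightarrow> x \<in> {1..l} \<and> y \<in> {1..m}"
  "Mid x y \<in> upper_to_mid ` points m k l \<longleftrightarrow> x \<in> {1..k} \<and> y \<in> {1..m}"
proof -
  have "lower_to_mid t = Mid x y \<longleftrightarrow> t = Lo x y" "upper_to_mid t = Mid x y \<longleftrightarrow> t = Up x y"
    if "t \<in> points m k l" for t
    using that by (cases t; auto)+
  then have "Mid x y \<in> lower_to_mid ` points m k l \<longleftrightarrow> Lo x y \<in> points m k l"
    "Mid x y \<in> upper_to_mid ` points m k l \<longleftrightarrow> Up x y \<in> points m k l"
    unfolding image_iff by metis+
  then show
    "Mid x y \<in> lower_to_mid ` points m k l \<longleftrightarrow> x \<in> {1..l} \<and> y \<in> {1..m}"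
    "Mid x y \<in> upper_to_mid ` points m k l \<longleftrightarrow> x \<in> {1..k} \<and> y \<in> {1..m}"
    by auto
qed

lemma finite_parts: "p \<in> parts m k l \<Longrightarrow> finite p"
  using finite_elements[OF finite_points] by (auto simp: parts_def)

lemma card_image_block:
  assumes "p \<in> parts m k l" "B \<in> p" "inj_on f (points m k l)"
  shows "card (f ` B) = card B"
proof (rule card_image)
  have "B \<subseteq> points m k l" using assms(1,2) partsD by blast
  then show "inj_on f B" using assms(3) inj_on_subset by blast
qed

text \<open>
  A class with \<open>e\<close> outer and \<open>i\<close> middle points is covered by \<open>(e + 2 i) / 2\<close> glued pairs. Being
  connected it has at most one point more than pairs, so \<open>e \<le> 2\<close>.
\<close>

lemma compose_pairs:
  assumes q: "q \<in> parts m k r" and p: "p \<in> parts m r l"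
    and cq: "\<And>B. B \<in> q \<Longrightarrow> card B = 2" and cp: "\<And>B. B \<in> p \<Longrightarrow> card B = 2"
    and D: "D \<in> compose p q"
  shows "card D = 2"
proof -
  let ?Gq = "(`) lower_to_mid ` q" and ?Gp = "(`) upper_to_mid ` p"
  let ?G = "glued_blocks p q"
  let ?X = "lower_to_mid ` points m k r" and ?Y = "upper_to_mid ` points m r l"
  have G: "?G = ?Gq \<union> ?Gp" by (simp add: glued_blocks_def)
  from D obtain C where C: "C \<in> \<Union>?G // joined ?G" and DC: "D = {s \<in> C. \<not> is_mid s}" "D \<noteq> {}"
    unfolding compose_eq by blast
  have cGq: "card B = 2" if "B \<in> ?Gq" for B
    using that card_image_block[OF q _ inj_on_lower_to_mid] cq by auto
  have cGp: "card B = 2" if "B \<in> ?Gp" for B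
    using that card_image_block[OF p _ inj_on_upper_to_mid] cp by auto
  have pX: "partition_on ?X ?Gq"
    using q by (auto simp: parts_def intro: partition_on_inj_image' inj_on_lower_to_mid)
  have pY: "partition_on ?Y ?Gp"
    using p by (auto simp: parts_def intro: partition_on_inj_image' inj_on_upper_to_mid)
  have X: "card (C \<inter> ?X) = 2 * card {B \<in> ?Gq. B \<subseteq> C}"
    by (rule card_class_Int[OF pX _ _ cGq C]) (auto simp: G)
  have Y: "card (C \<inter> ?Y) = 2 * card {B \<in> ?Gp. B \<subseteq> C}"
    by (rule card_class_Int[OF pY _ _ cGp C]) (auto simp: G)
  have fin: "finite ?Gq" "finite ?Gp" using finite_parts[OF q] finite_parts[OF p] by auto
  have "card C \<le> card {B \<in> ?G. B \<subseteq> C} + 1"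
    by (rule card_joined_class[OF _ _ C]) (use fin cGq cGp in \<open>auto simp: G\<close>)
  also have "{B \<in> ?G. B \<subseteq> C} = {B \<in> ?Gq. B \<subseteq> C} \<union> {B \<in> ?Gp. B \<subseteq> C}" by (auto simp: G)
  also have "card \<dots> \<le> card {B \<in> ?Gq. B \<subseteq> C} + card {B \<in> ?Gp. B \<subseteq> C}" by (rule card_Un_le)
  finally have le: "card C \<le> card {B \<in> ?Gq. B \<subseteq> C} + card {B \<in> ?Gp. B \<subseteq> C} + 1" by simp
  have Csub: "C \<subseteq> ?X \<union> ?Y"
  proof -
    have "\<Union>?G = ?X \<union> ?Y"
      using partition_onD1[OF pX] partition_onD1[OF pY] by (simp add: G)
    moreover have "C \<subseteq> \<Union>?G" using Union_quotient[OF equiv_joined, of ?G] C by blast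
    ultimately show ?thesis by simp
  qed
  have finC: "finite C" by (rule finite_subset[OF Csub]) simp
  define M where "M = {s \<in> C. is_mid s}"
  have mids: "s \<in> ?X \<inter> ?Y" if s: "s \<in> C" "is_mid s" for s
  proof -
    obtain x y where [simp]: "s = Mid x y" using s(2) by (cases s) auto
    have "s \<in> ?X \<union> ?Y" using s(1) Csub by blast
    then show ?thesis by (simp add: Mid_image)
  qed
  have outer: "is_mid s" if s: "s \<in> ?X" "s \<in> ?Y" for s
  proof -
    obtain t u where "t \<in> points m k r" "s = lower_to_mid t" "u \<in> points m r l" "s = upper_to_mid u"
      using s by blast
    then show ?thesis by (cases t; cases u) auto
  qed
  \<comment> \<open>Within the class, exactly the middle points belong to both layers, so adding the
    two traces counts each of them twice.\<close>
  have "(C \<inter> ?X) \<union> (C \<inter> ?Y) = C" using Csub by blast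
  moreover have "(C \<inter> ?X) \<inter> (C \<inter> ?Y) = M" unfolding M_def using mids outer by blast
  ultimately have "card (C \<inter> ?X) + card (C \<inter> ?Y) = card C + card M"
    using finC by (metis card_Un_Int finite_Int)
  moreover have "card C = card D + card M"
  proof -
    have "C = D \<union> M" "D \<inter> M = {}" by (auto simp: DC M_def)
    then show ?thesis using finC by (metis card_Un_disjoint finite_Un)
  qed
  moreover have "card D \<noteq> 0" using DC finC by auto
  \<comment> \<open>Both traces have even size, so \<open>card D + 2 * card M\<close> is even:
    \<open>card D\<close> is even, nonzero and at most 2.\<close>
  ultimately show ?thesis using X Y le by presburger
qed

lemma card_image_inj: "inj f \<Longrightarrow> card (f ` B) = card B"
  by (rule card_image) (erule inj_on_subset, simp)

lemma card_id_part: "B \<in> id_part m \<Longrightarrow> card B = 2"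
  by (auto simp: id_part_def)

lemma card_pair_part: "B \<in> pair_part m \<Longrightarrow> card B = 2"
  by (auto simp: pair_part_def)

lemma pairings_family: "pairings m = family m (\<lambda>_ _ p. \<forall>B\<in>p. card B = 2)"
  by (auto simp: pairings_def family_def all_parts_def)

lemma category_pairings:
  assumes "m \<ge> 1" shows "category m (pairings m)"
  unfolding pairings_family
proof (rule category_family[OF assms])
  show "\<forall>B\<in>id_part m. card B = 2" "\<forall>B\<in>pair_part m. card B = 2"
    using card_id_part card_pair_part by blast+
  show "\<forall>B\<in>compose p q. card B = 2"
    if "q \<in> parts m k r" "p \<in> parts m r l" "\<forall>B\<in>q. card B = 2" "\<forall>B\<in>p. card B = 2" for k r l p q
    using compose_pairs[OF that(1,2)] that(3,4) by blast
qed (auto simp: tensor_def involution_def card_image_inj inj_shift inj_flip)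

section \<open>Balanced partitions\<close>

text \<open>The columns are read from left to right, so column 1 gives the outermost map. The order
  matters as soon as the involutions do not commute.\<close>

primrec word :: "('b \<Rightarrow> 'a \<Rightarrow> 'a) \<Rightarrow> (nat \<Rightarrow> 'b) \<Rightarrow> nat \<Rightarrow> 'a \<Rightarrow> 'a" where
  "word \<phi> c 0 = id"
| "word \<phi> c (Suc n) = word \<phi> c n \<circ> \<phi> (c (Suc n))"

lemma word_add: "word \<phi> c (n + n') = word \<phi> c n \<circ> word \<phi> (\<lambda>x. c (n + x)) n'"
  by (induction n') (auto simp: o_assoc)

definition columns :: "nat \<Rightarrow> (nat \<Rightarrow> nat \<Rightarrow> point) \<Rightarrow> (point \<Rightarrow> 'b) \<Rightarrow> nat \<Rightarrow> 'b list" where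
  "columns m X lab x = map (\<lambda>y. lab (X x y)) [1..<Suc m]"

definition labelling :: "point set set \<Rightarrow> (point \<Rightarrow> 'b) \<Rightarrow> bool" where
  "labelling p lab \<longleftrightarrow> (\<forall>B\<in>p. \<forall>s\<in>B. \<forall>t\<in>B. lab s = lab t)"

lemma labelling_simps:
  "labelling (p \<union> q) lab \<longleftrightarrow> labelling p lab \<and> labelling q lab"
  "labelling ((`) f ` p) lab \<longleftrightarrow> labelling p (lab \<circ> f)"
  by (auto simp: labelling_def)

lemma labellingD: "labelling p lab \<Longrightarrow> B \<in> p \<Longrightarrow> s \<in> B \<Longrightarrow> t \<in> B \<Longrightarrow> lab s = lab t"
  unfolding labelling_def by blast

text \<open>An intertwiner condition: index the 0-1 matrix of \<open>p\<close> by the colourings of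
  the two rows, with entry 1 where they are jointly constant on blocks. Then \<open>p\<close> is
  balanced iff this matrix intertwines the diagonal operators that have the words as
  entries.\<close>

definition balanced ::
    "nat \<Rightarrow> ('b list \<Rightarrow> 'a \<Rightarrow> 'a) \<Rightarrow> nat \<Rightarrow> nat \<Rightarrow> point set set \<Rightarrow> bool" where
  "balanced m \<phi> k l p \<longleftrightarrow>
     (\<forall>lab. labelling p lab \<longrightarrow> word \<phi> (columns m Up lab) k = word \<phi> (columns m Lo lab) l)"

text \<open>A component with an outer point passes the colour of that point on to its middle points.
  This is well defined because the outer points of a component form one block of the
  composition.\<close>

lemma labelling_compose_extend:
  assumes "labelling (compose p q) lab"
  obtains mu where "labelling (glued_blocks p q) mu" "\<And>s. \<not> is_mid s \<Longrightarrow> mu s = lab s"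
proof
  let ?G = "glued_blocks p q"
  define F where "F s = {t. (s, t) \<in> joined ?G \<and> \<not> is_mid t}" for s
  \<comment> \<open>\<open>undefined\<close> colours the components that consist of middle points
    only: \<open>lab\<close> prescribes nothing there, and a constant respects the blocks.\<close>
  define mu where "mu s = (if is_mid s then (if F s = {} then undefined else lab (SOME t. t \<in> F s)) else lab s)" for s
  show "\<And>s. \<not> is_mid s \<Longrightarrow> mu s = lab s" by (simp add: mu_def)
  have F: "F s \<in> compose p q" if "F s \<noteq> {}" for s
  proof -
    have "s \<in> \<Union>?G" using that joined_sub[of ?G] unfolding F_def by blast
    then have "joined ?G `` {s} \<in> \<Union>?G // joined ?G" by (rule quotientI)
    moreover have "F s = {t \<in> joined ?G `` {s}. \<not> is_mid t}" by (auto simp: F_def)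
    ultimately show ?thesis using that unfolding compose_eq by blast
  qed
  have mu: "mu s = (if F s = {} then undefined else lab (SOME t. t \<in> F s))" if "B \<in> ?G" "s \<in> B" for B s
  proof (cases "is_mid s")
    case False
    then have s: "s \<in> F s" using that by (auto simp: F_def intro: joined_block)
    then have "(SOME t. t \<in> F s) \<in> F s" by (rule someI)
    then have "lab s = lab (SOME t. t \<in> F s)"
      using assms F s unfolding labelling_def by blast
    then show ?thesis using s False by (auto simp: mu_def)
  qed (simp add: mu_def)
  show "labelling ?G mu"
    unfolding labelling_def
  proof (intro ballI)
    fix B s t assume B: "B \<in> ?G" "s \<in> B" "t \<in> B"
    have "(s, t) \<in> joined ?G" using joined_block[OF B] .
    then have "joined ?G `` {s} = joined ?G `` {t}" by (rule equiv_class_eq[OF equiv_joined])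
    then have "F s = F t" unfolding F_def by blast
    then show "mu s = mu t" using mu[OF B(1,2)] mu[OF B(1,3)] by simp
  qed
qed

text \<open>Involutivity enters through \<open>pair_part\<close>, whose two columns carry equal
  colours and must cancel against an empty upper row. For a composition both outer words equal the
  word of the middle row.\<close>

lemma category_balanced:
  fixes \<phi> :: "'b list \<Rightarrow> 'a \<Rightarrow> 'a"
  assumes "m \<ge> 1" and inv: "\<And>c. \<phi> c \<circ> \<phi> c = id"
  shows "category m (family m (balanced m \<phi>))"
proof (rule category_family[OF assms(1)])
  show "balanced m \<phi> 1 1 (id_part m)"
    unfolding balanced_def
  proof (intro allI impI)
    fix lab :: "point \<Rightarrow> 'b" assume lab: "labelling (id_part m) lab"
    have "lab (Up 1 y) = lab (Lo 1 y)" if "y \<in> {1..m}" for y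
      by (rule labellingD[OF lab, of "{Up 1 y, Lo 1 y}"]) (use that in \<open>auto simp: id_part_def\<close>)
    then have "columns m Up lab 1 = columns m Lo lab 1" by (auto simp: columns_def)
    then show "word \<phi> (columns m Up lab) 1 = word \<phi> (columns m Lo lab) 1" by simp
  qed
  show "balanced m \<phi> 0 2 (pair_part m)"
    unfolding balanced_def
  proof (intro allI impI)
    fix lab :: "point \<Rightarrow> 'b" assume lab: "labelling (pair_part m) lab"
    have "lab (Lo 1 y) = lab (Lo 2 y)" if "y \<in> {1..m}" for y
      by (rule labellingD[OF lab, of "{Lo 1 y, Lo 2 y}"]) (use that in \<open>auto simp: pair_part_def\<close>)
    then have "columns m Lo lab 1 = columns m Lo lab 2" by (auto simp: columns_def)
    then show "word \<phi> (columns m Up lab) 0 = word \<phi> (columns m Lo lab) 2"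
      by (simp add: numeral_2_eq_2 inv)
  qed
next
  fix k l k' l' p q
  assume p: "balanced m \<phi> k l p" and q: "balanced m \<phi> k' l' q"
  show "balanced m \<phi> (k + k') (l + l') (tensor k l p q)"
    unfolding balanced_def
  proof (intro allI impI)
    fix lab :: "point \<Rightarrow> 'b" assume lab: "labelling (tensor k l p q) lab"
    have "labelling p lab" "labelling q (lab \<circ> shift k l)"
      using lab by (simp_all add: labelling_simps tensor_def)
    then have "word \<phi> (columns m Up lab) k = word \<phi> (columns m Lo lab) l"
      "word \<phi> (columns m Up (lab \<circ> shift k l)) k' = word \<phi> (columns m Lo (lab \<circ> shift k l)) l'"
      using p q by (auto simp: balanced_def)
    moreover have "columns m Up (lab \<circ> shift k l) = (\<lambda>x. columns m Up lab (k + x))"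
      "columns m Lo (lab \<circ> shift k l) = (\<lambda>x. columns m Lo lab (l + x))"
      by (auto simp: columns_def)
    ultimately show "word \<phi> (columns m Up lab) (k + k') = word \<phi> (columns m Lo lab) (l + l')"
      by (simp add: word_add)
  qed
next
  fix k r l p q
  assume q: "balanced m \<phi> k r q" and p: "balanced m \<phi> r l p"
  show "balanced m \<phi> k l (compose p q)"
    unfolding balanced_def
  proof (intro allI impI)
    fix lab :: "point \<Rightarrow> 'b" assume "labelling (compose p q) lab"
    then obtain mu where mu: "labelling (glued_blocks p q) mu" and eq: "\<And>s. \<not> is_mid s \<Longrightarrow> mu s = lab s"
      by (rule labelling_compose_extend) blast
    have "labelling q (mu \<circ> lower_to_mid)" "labelling p (mu \<circ> upper_to_mid)"
      using mu by (simp_all add: labelling_simps glued_blocks_def)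
    then have "word \<phi> (columns m Up (mu \<circ> lower_to_mid)) k = word \<phi> (columns m Lo (mu \<circ> lower_to_mid)) r"
      "word \<phi> (columns m Up (mu \<circ> upper_to_mid)) r = word \<phi> (columns m Lo (mu \<circ> upper_to_mid)) l"
      using p q by (auto simp: balanced_def)
    moreover have "columns m Up (mu \<circ> lower_to_mid) = columns m Up lab"
      "columns m Lo (mu \<circ> upper_to_mid) = columns m Lo lab"
      "columns m Lo (mu \<circ> lower_to_mid) = columns m Up (mu \<circ> upper_to_mid)"
      by (auto simp: columns_def eq)
    ultimately show "word \<phi> (columns m Up lab) k = word \<phi> (columns m Lo lab) l" by simp
  qed
next
  fix k l p
  assume p: "balanced m \<phi> k l p"
  show "balanced m \<phi> l k (involution p)"
    unfolding balanced_def
  proof (intro allI impI)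
    fix lab :: "point \<Rightarrow> 'b" assume "labelling (involution p) lab"
    then have "labelling p (lab \<circ> flip)" by (simp add: labelling_simps involution_def)
    then have "word \<phi> (columns m Up (lab \<circ> flip)) k = word \<phi> (columns m Lo (lab \<circ> flip)) l"
      using p by (simp add: balanced_def)
    moreover have "columns m Up (lab \<circ> flip) = columns m Lo lab"
      "columns m Lo (lab \<circ> flip) = columns m Up lab"
      by (auto simp: columns_def)
    ultimately show "word \<phi> (columns m Up lab) l = word \<phi> (columns m Lo lab) k" by simp
  qed
qed

section \<open>Noncrossing pairings\<close>

text \<open>The walk around the boundary combines both rows and has to be cut at chosen points,
  which suits a product along a list of points better than \<open>word\<close>.\<close>

definition lprod :: "('p \<Rightarrow> 'a \<Rightarrow> 'a) \<Rightarrow> 'p list \<Rightarrow> 'a \<Rightarrow> 'a" where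
  "lprod f xs = foldr (\<lambda>s g. f s \<circ> g) xs id"

lemma lprod_simps [simp]:
  "lprod f [] = id" "lprod f (s # xs) = f s \<circ> lprod f xs"
  by (simp_all add: lprod_def)

lemma lprod_append [simp]: "lprod f (xs @ ys) = lprod f xs \<circ> lprod f ys"
  by (induction xs) (simp_all add: o_assoc)

lemma lprod_id: "(\<And>s. s \<in> set xs \<Longrightarrow> f s = id) \<Longrightarrow> lprod f xs = id"
  by (induction xs) simp_all

lemma lprod_rev:
  assumes "\<And>s. f s \<circ> f s = id"
  shows "lprod f (rev xs) \<circ> lprod f xs = id"
proof (induction xs)
  case (Cons s xs)
  have "lprod f (rev (s # xs)) \<circ> lprod f (s # xs) = lprod f (rev xs) \<circ> (f s \<circ> f s) \<circ> lprod f xs"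
    by (simp add: o_assoc)
  also have "\<dots> = lprod f (rev xs) \<circ> lprod f xs" by (simp only: assms comp_id)
  finally show ?case by (simp only: Cons.IH)
qed simp

text \<open>The partner of the first point \<open>s\<close> splits the rest into an inner and an
  outer stretch, and the absence of crossings makes each of them closed under \<open>\<pi>\<close>.
  By induction both give the identity, and what is left is
  \<open>f s \<circ> f (\<pi> s) = id\<close>.\<close>

lemma lprod_noncrossing:
  assumes "sorted_wrt lt xs" "distinct xs"
    and partner: "\<And>s. s \<in> set xs \<Longrightarrow> \<pi> s \<in> set xs \<and> \<pi> s \<noteq> s \<and> \<pi> (\<pi> s) = s"
    and f: "\<And>s. s \<in> set xs \<Longrightarrow> f (\<pi> s) = f s" "\<And>s. f s \<circ> f s = id"
    and nc: "\<And>s t. s \<in> set xs \<Longrightarrow> t \<in> set xs \<Longrightarrow> lt s t \<Longrightarrow> lt t (\<pi> s) \<Longrightarrow> \<not> lt (\<pi> s) (\<pi> t)"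
  shows "lprod f xs = id"
  using assms(1,2) partner f(1) nc
proof (induction xs rule: length_induct)
  case (1 xs)
  note sorted = "1.prems"(1) and dist = "1.prems"(2) and partner = "1.prems"(3)
    and const = "1.prems"(4) and nc = "1.prems"(5)
  show ?case
  proof (cases xs)
    case (Cons s rest)
    have "\<pi> s \<in> set rest" using partner[of s] Cons by auto
    then obtain ys zs where rest: "rest = ys @ \<pi> s # zs" by (meson split_list)
    have xs: "xs = s # ys @ \<pi> s # zs" using Cons rest by simp
    have ys: "\<pi> u \<in> set ys" if u: "u \<in> set ys" for u
    proof -
      have "\<pi> u \<in> set xs" "\<pi> u \<noteq> u" "\<pi> (\<pi> u) = u" using partner[of u] u xs by auto
      moreover have "\<pi> u \<noteq> s" "\<pi> u \<noteq> \<pi> s"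
      proof -
        have "u \<noteq> s" "u \<noteq> \<pi> s" "\<pi> (\<pi> s) = s" using u dist partner[of s] by (auto simp: xs)
        then show "\<pi> u \<noteq> s" "\<pi> u \<noteq> \<pi> s" using calculation(3) by metis+
      qed
      \<comment> \<open>A partner beyond \<open>\<pi> s\<close> would produce the alternating order
        \<open>s\<close>, \<open>u\<close>, \<open>\<pi> s\<close>, \<open>\<pi> u\<close>.\<close>
      moreover have "\<pi> u \<notin> set zs"
      proof
        assume "\<pi> u \<in> set zs"
        then have "lt s u" "lt u (\<pi> s)" "lt (\<pi> s) (\<pi> u)"
          using sorted u by (auto simp: xs sorted_wrt_append)
        then show False using nc[of s u] u xs by auto
      qed
      ultimately show ?thesis by (auto simp: xs)
    qed
    have zs: "\<pi> u \<in> set zs" if u: "u \<in> set zs" for u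
    proof -
      have "\<pi> u \<in> set xs" "\<pi> u \<noteq> u" "\<pi> (\<pi> u) = u" using partner[of u] u xs by auto
      moreover have "\<pi> u \<noteq> s" "\<pi> u \<noteq> \<pi> s"
      proof -
        have "u \<noteq> s" "u \<noteq> \<pi> s" "\<pi> (\<pi> s) = s" using u dist partner[of s] by (auto simp: xs)
        then show "\<pi> u \<noteq> s" "\<pi> u \<noteq> \<pi> s" using calculation(3) by metis+
      qed
      \<comment> \<open>The inner stretch is already closed and \<open>\<pi>\<close> is an
        involution, so no outer point has its partner inside.\<close>
      moreover have "\<pi> u \<notin> set ys"
      proof
        assume "\<pi> u \<in> set ys"
        then have "u \<in> set ys" using ys[of "\<pi> u"] calculation(3) by simp
        then show False using u dist xs by auto
      qed
      ultimately show ?thesis by (auto simp: xs)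
    qed
    have "lprod f ys = id"
    proof (rule "1.IH"[rule_format])
      show "length ys < length xs" "sorted_wrt lt ys" "distinct ys"
        using sorted dist by (auto simp: xs sorted_wrt_append)
      show "\<pi> u \<in> set ys \<and> \<pi> u \<noteq> u \<and> \<pi> (\<pi> u) = u" if "u \<in> set ys" for u
        using ys[OF that] partner[of u] that xs by auto
      show "f (\<pi> u) = f u" if "u \<in> set ys" for u using const[of u] that xs by auto
      show "\<not> lt (\<pi> u) (\<pi> v)" if "u \<in> set ys" "v \<in> set ys" "lt u v" "lt v (\<pi> u)" for u v
        using nc[of u v] that xs by auto
    qed
    moreover have "lprod f zs = id"
    proof (rule "1.IH"[rule_format])
      show "length zs < length xs" "sorted_wrt lt zs" "distinct zs"
        using sorted dist by (auto simp: xs sorted_wrt_append)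
      show "\<pi> u \<in> set zs \<and> \<pi> u \<noteq> u \<and> \<pi> (\<pi> u) = u" if "u \<in> set zs" for u
        using zs[OF that] partner[of u] that xs by auto
      show "f (\<pi> u) = f u" if "u \<in> set zs" for u using const[of u] that xs by auto
      show "\<not> lt (\<pi> u) (\<pi> v)" if "u \<in> set zs" "v \<in> set zs" "lt u v" "lt v (\<pi> u)" for u v
        using nc[of u v] that xs by auto
    qed
    moreover have "f (\<pi> s) = f s" using const[of s] xs by auto
    ultimately show ?thesis by (simp add: xs f(2))
  qed simp
qed

definition boundary :: "nat \<Rightarrow> nat \<Rightarrow> point list" where
  "boundary k l = map (\<lambda>x. Up x 1) [1..<Suc k] @ rev (map (\<lambda>x. Lo x 1) [1..<Suc l])"

lemma set_boundary: "set (boundary k l) = points 1 k l"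
proof (rule set_eqI)
  fix s show "s \<in> set (boundary k l) \<longleftrightarrow> s \<in> points 1 k l"
    by (cases s) (auto simp: boundary_def image_iff)
qed

lemma sorted_boundary: "sorted_wrt before (boundary k l)"
proof -
  have "sorted_wrt (<) [1..<Suc n]" for n by (rule sorted_wrt_upt)
  then have "sorted_wrt before (map (\<lambda>x. Up x 1) [1..<Suc k])"
    "sorted_wrt before (rev (map (\<lambda>x. Lo x 1) [1..<Suc l]))"
    by (simp_all add: sorted_wrt_map sorted_wrt_rev del: upt_Suc)
  then show ?thesis by (auto simp: boundary_def sorted_wrt_append simp del: upt_Suc)
qed

lemma before_asym: "before s t \<Longrightarrow> \<not> before t s"
  by (cases s; cases t) auto

lemma before_irrefl [simp]: "\<not> before s s"
  using before_asym by blast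

lemma distinct_boundary: "distinct (boundary k l)"
  by (auto simp: boundary_def distinct_map inj_on_def)

lemma word_eq_lprod: "word \<phi> (columns 1 X lab) k = lprod (\<lambda>s. \<phi> [lab s]) (map (\<lambda>x. X x 1) [1..<Suc k])"
  by (induction k) (simp_all add: columns_def)

text \<open>The walk meets the lower row from right to left, and a reversed word of involutions is
  the inverse. So the boundary product is the upper word times the inverse of the lower one.\<close>

lemma words_eq_iff_lprod_boundary:
  assumes "\<And>c. \<phi> c \<circ> \<phi> c = id"
  shows "word \<phi> (columns 1 Up lab) k = word \<phi> (columns 1 Lo lab) l
    \<longleftrightarrow> lprod (\<lambda>s. \<phi> [lab s]) (boundary k l) = id" (is "?U = ?L \<longleftrightarrow> _")
proof -
  let ?f = "\<lambda>s. \<phi> [lab s]" and ?lo = "map (\<lambda>x. Lo x 1) [1..<Suc l]"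
  let ?L' = "lprod ?f (rev ?lo)"
  have L: "?L' \<circ> ?L = id" using lprod_rev[of ?f ?lo] assms unfolding word_eq_lprod by blast
  have R: "?L \<circ> ?L' = id"
    using lprod_rev[of ?f "rev ?lo"] assms unfolding word_eq_lprod rev_rev_ident by blast
  have eq: "lprod ?f (boundary k l) = ?U \<circ> ?L'"
    by (simp only: boundary_def word_eq_lprod lprod_append)
  show ?thesis
  proof
    assume "?U = ?L"
    then show "lprod ?f (boundary k l) = id" unfolding eq using R by (simp only:)
  next
    assume "lprod ?f (boundary k l) = id"
    then have *: "?U \<circ> ?L' = id" unfolding eq .
    have "?U = ?U \<circ> (?L' \<circ> ?L)" unfolding L by simp
    also have "\<dots> = (?U \<circ> ?L') \<circ> ?L" by (simp only: o_assoc)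
    finally show "?U = ?L" unfolding * by simp
  qed
qed

lemma pairing_partner:
  assumes p: "p \<in> parts m k l" and card: "\<And>B. B \<in> p \<Longrightarrow> card B = 2"
  obtains \<pi> where "\<And>s. s \<in> points m k l \<Longrightarrow> {s, \<pi> s} \<in> p \<and> \<pi> s \<in> points m k l \<and> \<pi> s \<noteq> s \<and> \<pi> (\<pi> s) = s"
proof -
  have "\<exists>t. {s, t} \<in> p \<and> t \<noteq> s" if "s \<in> points m k l" for s
  proof -
    obtain B where B: "B \<in> p" "s \<in> B" using \<open>s \<in> points m k l\<close> partsD[OF p] by blast
    then obtain u v where "B = {u, v}" "u \<noteq> v" using card card_2_iff by metis
    then show ?thesis using B by (auto simp: insert_commute)
  qed
  then obtain \<pi> where \<pi>: "\<And>s. s \<in> points m k l \<Longrightarrow> {s, \<pi> s} \<in> p \<and> \<pi> s \<noteq> s" by metis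
  have "\<pi> s \<in> points m k l \<and> \<pi> (\<pi> s) = s" if s: "s \<in> points m k l" for s
  proof -
    have in_pts: "\<pi> s \<in> points m k l" using \<pi>[OF s] partsD[OF p] by blast
    have "disjoint p" using p by (simp add: parts_def partition_on_def)
    moreover have "{s, \<pi> s} \<in> p" "{\<pi> s, \<pi> (\<pi> s)} \<in> p" using \<pi>[OF s] \<pi>[OF in_pts] by auto
    moreover have "{s, \<pi> s} \<inter> {\<pi> s, \<pi> (\<pi> s)} \<noteq> {}" by blast
    ultimately have "{s, \<pi> s} = {\<pi> s, \<pi> (\<pi> s)}" unfolding disjoint_def by meson
    then show ?thesis using in_pts \<pi>[OF in_pts] by (auto simp: doubleton_eq_iff)
  qed
  then show ?thesis using that \<pi> by blast
qed

text \<open>Equal letters cancel in nested pairs, whatever the involutions are. It is the converse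
  that depends on choosing them well.\<close>

lemma balanced_if_noncrossing:
  assumes p: "p \<in> parts 1 k l" and card: "\<And>B. B \<in> p \<Longrightarrow> card B = 2"
    and nc: "noncrossing p" and inv: "\<And>c. \<phi> c \<circ> \<phi> c = id"
  shows "balanced 1 \<phi> k l p"
  unfolding balanced_def
proof (intro allI impI)
  fix lab :: "point \<Rightarrow> 'a" assume lab: "labelling p lab"
  obtain \<pi> where \<pi>: "\<And>s. s \<in> points 1 k l
      \<Longrightarrow> {s, \<pi> s} \<in> p \<and> \<pi> s \<in> points 1 k l \<and> \<pi> s \<noteq> s \<and> \<pi> (\<pi> s) = s"
    using pairing_partner[OF p card] by blast
  have "lprod (\<lambda>s. \<phi> [lab s]) (boundary k l) = id"
  proof (rule lprod_noncrossing[where lt = before and \<pi> = \<pi>])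
    show "\<phi> [lab (\<pi> s)] = \<phi> [lab s]" if "s \<in> set (boundary k l)" for s
      using \<pi>[of s] that labellingD[OF lab, of "{s, \<pi> s}" "\<pi> s" s] by (simp add: set_boundary)
    fix s t assume st: "s \<in> set (boundary k l)" "t \<in> set (boundary k l)" "before s t" "before t (\<pi> s)"
    \<comment> \<open>\<open>t\<close> lies strictly between \<open>s\<close> and
      \<open>\<pi> s\<close>, so it is neither of them.\<close>
    have "{s, \<pi> s} \<noteq> {t, \<pi> t}" using st(3,4) before_asym by (auto simp: doubleton_eq_iff)
    then show "\<not> before (\<pi> s) (\<pi> t)"
    proof -
      have "{s, \<pi> s} \<in> p" "{t, \<pi> t} \<in> p" using \<pi> st(1,2) by (simp_all add: set_boundary)
      with \<open>{s, \<pi> s} \<noteq> {t, \<pi> t}\<close> nc st(3,4) show ?thesis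
        unfolding noncrossing_def by (meson insertI1 insertI2)
    qed
  qed (use \<pi> in \<open>simp_all add: set_boundary sorted_boundary distinct_boundary inv\<close>)
  then show "word \<phi> (columns 1 Up lab) k = word \<phi> (columns 1 Lo lab) l"
    using words_eq_iff_lprod_boundary[of \<phi> lab k l, OF inv] by blast
qed

text \<open>The reflection of the line at \<open>x / 2\<close>. The reflections for \<open>x\<close>
  and \<open>y\<close> compose to the translation by \<open>x - y\<close>, so two different ones do
  not commute.\<close>

definition reflection :: "int \<Rightarrow> int \<Rightarrow> int" where
  "reflection x z = x - z"

lemma reflection_reflection [simp]: "reflection x \<circ> reflection x = id"
  by (auto simp: reflection_def)

text \<open>Colour 0 silences a point, so that a colouring can single out two blocks. Reading the
  head of the list means that on two levels only the first level is seen.\<close>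

definition nc_word :: "int list \<Rightarrow> int \<Rightarrow> int" where
  "nc_word c = (if hd c = 0 then id else reflection (hd c))"

lemma nc_word_involutive: "nc_word c \<circ> nc_word c = id"
  by (simp add: nc_word_def)

lemma sorted_before_split:
  assumes "sorted_wrt before xs" "s \<in> set xs"
  obtains ys zs where "xs = ys @ s # zs" "sorted_wrt before zs"
    "\<And>t. t \<in> set xs \<Longrightarrow> before s t \<Longrightarrow> t \<in> set zs"
proof -
  obtain ys zs where xs: "xs = ys @ s # zs" using assms(2) by (meson split_list)
  have "t \<in> set zs" if "t \<in> set xs" "before s t" for t
  proof -
    have "t \<noteq> s" using that(2) by auto
    moreover have "t \<notin> set ys" using assms(1) before_asym that(2) xs by (auto simp: sorted_wrt_append)
    ultimately show ?thesis using that(1) xs by auto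
  qed
  then show ?thesis using that xs assms(1) by (auto simp: sorted_wrt_append)
qed

lemma before_trans: "before s t \<Longrightarrow> before t u \<Longrightarrow> before s u"
  by (cases s; cases t; cases u) auto

text \<open>
  Give the two crossing blocks the reflections at 1/2 and 1, and all other points the identity:
  the word around the boundary is then a translation by \<open>\<plusminus>2\<close>.
\<close>

lemma noncrossing_if_balanced:
  assumes p: "p \<in> parts 1 k l" and card: "\<And>B. B \<in> p \<Longrightarrow> card B = 2"
    and bal: "balanced 1 nc_word k l p"
  shows "noncrossing p"
  unfolding noncrossing_def
proof
  assume "\<exists>A\<in>p. \<exists>B\<in>p. A \<noteq> B \<and>
    (\<exists>s\<in>A. \<exists>t\<in>B. \<exists>s'\<in>A. \<exists>t'\<in>B. before s t \<and> before t s' \<and> before s' t')"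
  then obtain A B s t s' t' where AB: "A \<in> p" "B \<in> p" "A \<noteq> B" and in_A: "s \<in> A" "s' \<in> A" and in_B: "t \<in> B" "t' \<in> B"
    and order: "before s t" "before t s'" "before s' t'"
    by blast
  define lab :: "point \<Rightarrow> int" where "lab u = (if u \<in> A then 1 else if u \<in> B then 2 else 0)" for u
  have disj: "disjoint p" using p by (simp add: parts_def partition_on_def)
  then have "A \<inter> B = {}" using AB by (auto simp: disjoint_def)
  have "labelling p lab"
    unfolding labelling_def
  proof (intro ballI)
    fix C u v assume C: "C \<in> p" "u \<in> C" "v \<in> C"
    have "u \<in> A \<longleftrightarrow> v \<in> A" "u \<in> B \<longleftrightarrow> v \<in> B"
      using C AB disj unfolding disjoint_def by blast+
    then show "lab u = lab v" by (simp add: lab_def)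
  qed
  then have id: "lprod (\<lambda>u. nc_word [lab u]) (boundary k l) = id"
    using bal words_eq_iff_lprod_boundary[of nc_word lab k l, OF nc_word_involutive]
    unfolding balanced_def by blast
  have "s \<noteq> s'" "t \<noteq> t'" using order before_asym by blast+
  moreover have "card A = 2" "card B = 2" using card AB by auto
  ultimately have "A = {s, s'}" "B = {t, t'}"
    using in_A in_B unfolding card_2_iff by blast+
  have in_pts: "s \<in> set (boundary k l)" "t \<in> set (boundary k l)" "s' \<in> set (boundary k l)" "t' \<in> set (boundary k l)"
    using in_A in_B AB partsD[OF p] set_boundary by blast+
  \<comment> \<open>The boundary is cut at the four alternating points one after the other; each
    remaining tail is sorted and keeps the points still to come.\<close>
  obtain x0 r1 where r1: "boundary k l = x0 @ s # r1" "sorted_wrt before r1"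
    "\<And>u. u \<in> set (boundary k l) \<Longrightarrow> before s u \<Longrightarrow> u \<in> set r1"
    using sorted_before_split[OF sorted_boundary in_pts(1)] by blast
  have "t \<in> set r1" "s' \<in> set r1" "t' \<in> set r1"
    using r1(3) in_pts order before_trans by blast+
  obtain x1 r2 where r2: "r1 = x1 @ t # r2" "sorted_wrt before r2"
    "\<And>u. u \<in> set r1 \<Longrightarrow> before t u \<Longrightarrow> u \<in> set r2"
    using sorted_before_split[OF r1(2) \<open>t \<in> set r1\<close>] by blast
  have "s' \<in> set r2" "t' \<in> set r2"
    using r2(3) \<open>s' \<in> set r1\<close> \<open>t' \<in> set r1\<close> order before_trans by blast+
  obtain x2 r3 where r3: "r2 = x2 @ s' # r3" "sorted_wrt before r3"
    "\<And>u. u \<in> set r2 \<Longrightarrow> before s' u \<Longrightarrow> u \<in> set r3"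
    using sorted_before_split[OF r2(2) \<open>s' \<in> set r2\<close>] by blast
  have "t' \<in> set r3" using r3(3) \<open>t' \<in> set r2\<close> order by blast
  then obtain x3 x4 where r4: "r3 = x3 @ t' # x4" by (meson split_list)
  have xs: "boundary k l = x0 @ s # x1 @ t # x2 @ s' # x3 @ t' # x4"
    using r1(1) r2(1) r3(1) r4 by simp
  have "nc_word [lab u] = id" if "u \<notin> {s, s', t, t'}" for u
    using that \<open>A = {s, s'}\<close> \<open>B = {t, t'}\<close> by (auto simp: lab_def nc_word_def)
  moreover have "{s, s', t, t'} \<inter> (set x0 \<union> set x1 \<union> set x2 \<union> set x3 \<union> set x4) = {}"
    using distinct_boundary[of k l] unfolding xs by auto
  ultimately have "lprod (\<lambda>u. nc_word [lab u]) x = id" if "x \<in> {x0, x1, x2, x3, x4}" for x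
    using that by (intro lprod_id) blast
  moreover have "lab s = 1" "lab s' = 1" "lab t = 2" "lab t' = 2"
    using in_A in_B \<open>A \<inter> B = {}\<close> by (auto simp: lab_def)
  ultimately have "lprod (\<lambda>u. nc_word [lab u]) (boundary k l)
      = reflection 1 \<circ> (reflection 2 \<circ> (reflection 1 \<circ> reflection 2))"
    by (simp add: xs nc_word_def)
  then have "(reflection 1 \<circ> (reflection 2 \<circ> (reflection 1 \<circ> reflection 2))) 0 = id 0"
    using id by simp
  then show False by (simp add: reflection_def)
qed

text \<open>A geometric condition is traded for one that is visibly stable under composition:
  \<open>nc_pairings\<close> becomes an intersection of two categories.\<close>

lemma nc_pairings_family:
  "nc_pairings = family 1 (\<lambda>k l p. (\<forall>B\<in>p. card B = 2) \<and> balanced 1 nc_word k l p)"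
proof -
  have "noncrossing p \<longleftrightarrow> balanced 1 nc_word k l p"
    if "p \<in> parts 1 k l" "\<forall>B\<in>p. card B = 2" for p k l
    using balanced_if_noncrossing[of p k l nc_word] noncrossing_if_balanced[of p k l] that
      nc_word_involutive by blast
  then show ?thesis
    unfolding nc_pairings_def pairings_family family_def by blast
qed

lemma category_Int:
  assumes C: "category m C" and D: "category m D"
  shows "category m (C \<inter> D)"
  unfolding category_def
proof (intro conjI allI ballI)
  show "C \<inter> D \<subseteq> all_parts m" using categoryD(1)[OF C] by blast
  show "id_part m \<in> C \<inter> D" "pair_part m \<in> C \<inter> D" using C D by (simp_all add: categoryD)
  show "involution p \<in> C \<inter> D" if "p \<in> C \<inter> D" for p
    using that categoryD(6)[OF C] categoryD(6)[OF D] by blast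
  show "tensor k l p q \<in> C \<inter> D"
    if "p \<in> C \<inter> D \<inter> parts m k l" "q \<in> C \<inter> D \<inter> parts m k' l'" for k l k' l' p q
    using that categoryD(4)[OF C, of p k l q k' l'] categoryD(4)[OF D, of p k l q k' l'] by simp
  show "compose p q \<in> C \<inter> D"
    if "q \<in> C \<inter> D \<inter> parts m k r" "p \<in> C \<inter> D \<inter> parts m r l" for k r l p q
    using that categoryD(5)[OF C, of q k r p l] categoryD(5)[OF D, of q k r p l] by simp
qed

lemma family_Int:
  assumes "m \<ge> 1"
  shows "family m (\<lambda>k l p. P k l p \<and> Q k l p) = family m P \<inter> family m Q"
proof (intro set_eqI iffI)
  fix p assume "p \<in> family m P \<inter> family m Q"
  then obtain k l where "p \<in> parts m k l" "P k l p" "p \<in> family m Q" by (auto simp: family_def)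
  then show "p \<in> family m (\<lambda>k l p. P k l p \<and> Q k l p)"
    using family_iff[OF assms] by auto
qed (auto simp: family_def)

lemma category_nc_pairings: "category 1 nc_pairings"
proof -
  have eq: "nc_pairings = pairings 1 \<inter> family 1 (balanced 1 nc_word)"
    unfolding nc_pairings_family pairings_family by (rule family_Int) simp
  show ?thesis
    unfolding eq by (intro category_Int category_pairings category_balanced nc_word_involutive; simp)
qed

section \<open>Products of two levels\<close>

lemma joined_image_mono:
  assumes "(s, t) \<in> joined G" "(`) f ` G \<subseteq> K"
  shows "(f s, f t) \<in> joined K"
  using assms(1) unfolding joined_def[of G]
proof (induction rule: trancl_induct)
  case (base t)
  then show ?case using assms(2) by (auto intro!: joined_block[of "f ` B" K for B])
next
  case (step t u)
  then have "(f t, f u) \<in> joined K" using assms(2) by (auto intro!: joined_block[of "f ` B" K for B])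
  with step.IH show ?case unfolding joined_def by (rule trancl_trans)
qed

text \<open>A chain of blocks that starts in the image of \<open>G\<close> never reaches
  \<open>H\<close>, because the supports are disjoint, and it can be pulled back block by block
  along the injective \<open>f\<close>.\<close>

lemma joined_class_image:
  assumes inj: "inj_on f (\<Union>G)" and disj: "f ` \<Union>G \<inter> \<Union>H = {}" and s: "s \<in> \<Union>G"
  shows "joined ((`) f ` G \<union> H) `` {f s} = f ` (joined G `` {s})"
proof
  let ?K = "(`) f ` G \<union> H"
  show "f ` (joined G `` {s}) \<subseteq> joined ?K `` {f s}"
    using joined_image_mono[of s _ G f ?K] by auto
  have block: "\<exists>t'. v = f t' \<and> (t, t') \<in> joined G" if B: "t \<in> \<Union>G" "B \<in> ?K" "f t \<in> B" "v \<in> B" for t v B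
  proof -
    have "B \<notin> H" using B disj by blast
    then obtain B' where B': "B' \<in> G" "B = f ` B'" using B(2) by blast
    then obtain t'' where "t'' \<in> B'" "f t = f t''" using B(3) by blast
    then have "t \<in> B'" using inj B(1) B'(1) by (metis UnionI inj_onD)
    then show ?thesis using B(4) B' joined_block[OF B'(1)] by blast
  qed
  have "\<exists>t. u = f t \<and> (s, t) \<in> joined G" if "(f s, u) \<in> joined ?K" for u
    using that unfolding joined_def[of ?K]
  proof (induction rule: trancl_induct)
    case (base u)
    then show ?case using block[OF s] by blast
  next
    case (step u v)
    then obtain t B where t: "u = f t" "(s, t) \<in> joined G" and B: "B \<in> ?K" "u \<in> B" "v \<in> B" by blast
    have "t \<in> \<Union>G" using t(2) joined_sub[of G] by blast
    then obtain t' where "v = f t'" "(t, t') \<in> joined G" using block[of t B v] t(1) B by blast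
    then show ?case using t(2) unfolding joined_def by (blast intro: trancl_trans)
  qed
  then show "joined ?K `` {f s} \<subseteq> f ` (joined G `` {s})" by blast
qed

lemma quotient_image: "A // r = (\<lambda>x. r `` {x}) ` A"
  by (auto simp: quotient_def)

lemma joined_quotient_Un:
  assumes "inj_on f (\<Union>G)" "inj_on g (\<Union>H)" "f ` \<Union>G \<inter> g ` \<Union>H = {}"
  defines "K \<equiv> (`) f ` G \<union> (`) g ` H"
  shows "\<Union>K // joined K = (`) f ` (\<Union>G // joined G) \<union> (`) g ` (\<Union>H // joined H)"
proof -
  have "joined K `` {f s} = f ` (joined G `` {s})" if "s \<in> \<Union>G" for s
    unfolding K_def using assms(3) by (intro joined_class_image[OF assms(1) _ that]) auto
  moreover have "joined K `` {g s} = g ` (joined H `` {s})" if "s \<in> \<Union>H" for s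
    unfolding K_def Un_commute[of "(`) f ` G"] using assms(3)
    by (intro joined_class_image[OF assms(2) _ that]) auto
  moreover have "\<Union>K = f ` \<Union>G \<union> g ` \<Union>H" by (auto simp: K_def)
  ultimately show ?thesis
    unfolding quotient_image by (simp add: image_Un image_image cong: image_cong_simp)
qed

text \<open>The union inside \<open>two_level_product\<close>, named so that it can be shown to
  commute with the category operations.\<close>

definition stack :: "point set set \<Rightarrow> point set set \<Rightarrow> point set set" where
  "stack p1 p2 = (`) (to_level 1) ` p1 \<union> (`) (to_level 2) ` p2"

lemma to_level_commute:
  "to_level y (shift k l s) = shift k l (to_level y s)"
  "to_level y (flip s) = flip (to_level y s)"
  "to_level y (lower_to_mid s) = lower_to_mid (to_level y s)"
  "to_level y (upper_to_mid s) = upper_to_mid (to_level y s)"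
  by (cases s; simp)+

lemma is_mid_to_level [simp]: "is_mid (to_level y s) = is_mid s"
  by (cases s) auto

lemma to_level_eq_same: "to_level 1 s = s \<Longrightarrow> to_level 1 t = t \<Longrightarrow> to_level y s = to_level y t \<Longrightarrow> s = t"
  by (cases s; cases t) auto

lemma to_level_neq: "to_level 1 s \<noteq> to_level 2 t"
  by (cases s; cases t) auto

lemma to_level_points: "s \<in> points 1 k l \<Longrightarrow> to_level 1 s = s"
  by (cases s) auto

text \<open>The equation \<open>to_level 1 s = s\<close> expresses that \<open>s\<close> is on level
  1. It replaces membership in \<open>points 1 k l\<close> because glued blocks also contain middle
  points.\<close>

lemma inj_on_to_level: "(\<And>s. s \<in> A \<Longrightarrow> to_level 1 s = s) \<Longrightarrow> inj_on (to_level y) A"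
  by (rule inj_onI) (rule to_level_eq_same)

lemma points_two_levels: "points 2 k l = to_level 1 ` points 1 k l \<union> to_level 2 ` points 1 k l"
proof (rule set_eqI)
  fix s
  have "s \<in> to_level y ` points 1 k l \<longleftrightarrow> to_level 1 s \<in> points 1 k l \<and> s = to_level y s" for y
  proof
    assume "s \<in> to_level y ` points 1 k l"
    then obtain t where "t \<in> points 1 k l" "s = to_level y t" by blast
    then show "to_level 1 s \<in> points 1 k l \<and> s = to_level y s" by (cases t) auto
  next
    assume "to_level 1 s \<in> points 1 k l \<and> s = to_level y s"
    then show "s \<in> to_level y ` points 1 k l"
      by (intro image_eqI[of _ _ "to_level 1 s"]) (cases s; simp)+
  qed
  then show "s \<in> points 2 k l \<longleftrightarrow> s \<in> to_level 1 ` points 1 k l \<union> to_level 2 ` points 1 k l"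
    by (cases s) auto
qed

lemma stack_parts:
  assumes "p1 \<in> parts 1 k l" "p2 \<in> parts 1 k l"
  shows "stack p1 p2 \<in> parts 2 k l"
proof -
  have "partition_on (to_level y ` points 1 k l) ((`) (to_level y) ` p)" if "p \<in> parts 1 k l" for y p
    using that to_level_points unfolding parts_def
    by (intro partition_on_inj_image' inj_on_to_level) blast+
  moreover have "to_level 1 ` points 1 k l \<inter> to_level 2 ` points 1 k l = {}"
    using to_level_neq by blast
  ultimately show ?thesis
    using assms unfolding parts_def[of 2] stack_def points_two_levels
    by (simp add: partition_on_Un)
qed

lemma stack_id_part: "id_part 2 = stack (id_part 1) (id_part 1)"
proof -
  have "{1..2::nat} = {1, 2}" by auto
  then show ?thesis unfolding id_part_def stack_def by auto
qed

lemma stack_pair_part: "pair_part 2 = stack (pair_part 1) (pair_part 1)"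
proof -
  have "{1..2::nat} = {1, 2}" by auto
  then show ?thesis unfolding pair_part_def stack_def by auto
qed

lemma stack_tensor: "tensor k l (stack p1 p2) (stack q1 q2) = stack (tensor k l p1 q1) (tensor k l p2 q2)"
  by (simp add: tensor_def stack_def image_Un image_image to_level_commute Un_ac)

lemma stack_involution: "involution (stack p1 p2) = stack (involution p1) (involution p2)"
  by (simp add: involution_def stack_def image_Un image_image to_level_commute)

lemma stack_glued: "glued_blocks (stack p1 p2) (stack q1 q2) = stack (glued_blocks p1 q1) (glued_blocks p2 q2)"
  by (simp add: glued_blocks_def stack_def image_Un image_image to_level_commute Un_ac)

text \<open>Gluing never joins points of different levels, so the classes of the stacked partitions
  are those of the two levels separately.\<close>

lemma stack_compose:
  assumes "q1 \<in> parts 1 k r" "p1 \<in> parts 1 r l" "q2 \<in> parts 1 k r" "p2 \<in> parts 1 r l"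
  shows "compose (stack p1 p2) (stack q1 q2) = stack (compose p1 q1) (compose p2 q2)"
proof -
  let ?G = "glued_blocks p1 q1" and ?H = "glued_blocks p2 q2" and ?K = "glued_blocks (stack p1 p2) (stack q1 q2)"
  have K: "?K = (`) (to_level 1) ` ?G \<union> (`) (to_level 2) ` ?H" unfolding stack_glued by (simp add: stack_def)
  have G1: "to_level 1 s = s" if "s \<in> \<Union>?G" for s
    using that to_level_points[of s k l] unfolding Union_glued[OF assms(1,2)] by auto
  have H1: "to_level 1 s = s" if "s \<in> \<Union>?H" for s
    using that to_level_points[of s k l] unfolding Union_glued[OF assms(3,4)] by auto
  have "\<Union>?K // joined ?K = (`) (to_level 1) ` (\<Union>?G // joined ?G) \<union> (`) (to_level 2) ` (\<Union>?H // joined ?H)"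
    unfolding K
  proof (rule joined_quotient_Un)
    show "inj_on (to_level 1) (\<Union>?G)" using G1 by (rule inj_on_to_level)
    show "inj_on (to_level 2) (\<Union>?H)" using H1 by (rule inj_on_to_level)
    show "to_level 1 ` \<Union>?G \<inter> to_level 2 ` \<Union>?H = {}" using to_level_neq by blast
  qed
  \<comment> \<open>Moving to a level respects the deletion of middle points and, since images of
    nonempty sets are nonempty, the removal of the empty block.\<close>
  moreover have "(\<lambda>B. {s \<in> B. \<not> is_mid s}) ` (`) (to_level y) ` Q - {{}}
      = (`) (to_level y) ` ((\<lambda>B. {s \<in> B. \<not> is_mid s}) ` Q - {{}})" for y Q
  proof -
    have "{s \<in> to_level y ` C. \<not> is_mid s} = to_level y ` {s \<in> C. \<not> is_mid s}" for C by auto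
    then have "(\<lambda>B. {s \<in> B. \<not> is_mid s}) ` (`) (to_level y) ` Q
        = (`) (to_level y) ` (\<lambda>B. {s \<in> B. \<not> is_mid s}) ` Q"
      by (simp add: image_image)
    moreover have "(`) f ` X - {{}} = (`) f ` (X - {{}})" for f :: "point \<Rightarrow> point" and X by auto
    ultimately show ?thesis by simp
  qed
  ultimately show ?thesis
    unfolding compose_eq stack_def by (simp only: image_Un Un_Diff)
qed

lemma two_level_product_family:
  "two_level_product C1 C2 = family 2 (\<lambda>k l p. \<exists>p1 p2. p1 \<in> C1 \<inter> parts 1 k l \<and> p2 \<in> C2 \<inter> parts 1 k l \<and> p = stack p1 p2)"
  unfolding two_level_product_def family_def using stack_parts by (fastforce simp: stack_def)

lemma category_two_level_product:
  assumes C1: "category 1 C1" and C2: "category 1 C2"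
  shows "category 2 (two_level_product C1 C2)"
  unfolding two_level_product_family
proof (rule category_family, goal_cases)
  case 2
  then show ?case
    using categoryD(2)[OF C1] categoryD(2)[OF C2] id_part_parts[of 1] stack_id_part by blast
next
  case 3
  then show ?case
    using categoryD(3)[OF C1] categoryD(3)[OF C2] pair_part_parts[of 1] stack_pair_part by blast
next
  case (4 k l k' l' p q)
  then obtain p1 p2 q1 q2 where *: "p1 \<in> C1" "p1 \<in> parts 1 k l" "p2 \<in> C2" "p2 \<in> parts 1 k l"
    "q1 \<in> C1" "q1 \<in> parts 1 k' l'" "q2 \<in> C2" "q2 \<in> parts 1 k' l'" "p = stack p1 p2" "q = stack q1 q2"
    by blast
  then have "tensor k l p1 q1 \<in> C1 \<inter> parts 1 (k + k') (l + l')" "tensor k l p2 q2 \<in> C2 \<inter> parts 1 (k + k') (l + l')"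
    using categoryD(4)[OF C1] categoryD(4)[OF C2] tensor_parts by auto
  then show ?case using stack_tensor *(9,10) by blast
next
  case (5 k r l p q)
  then obtain p1 p2 q1 q2 where *: "q1 \<in> C1" "q1 \<in> parts 1 k r" "q2 \<in> C2" "q2 \<in> parts 1 k r"
    "p1 \<in> C1" "p1 \<in> parts 1 r l" "p2 \<in> C2" "p2 \<in> parts 1 r l" "p = stack p1 p2" "q = stack q1 q2"
    by blast
  then have "compose p1 q1 \<in> C1 \<inter> parts 1 k l" "compose p2 q2 \<in> C2 \<inter> parts 1 k l"
    using categoryD(5)[OF C1] categoryD(5)[OF C2] compose_parts by auto
  then show ?case using stack_compose[OF *(2,6,4,8)] *(9,10) by blast
next
  case (6 k l p)
  then obtain p1 p2 where *: "p1 \<in> C1" "p1 \<in> parts 1 k l" "p2 \<in> C2" "p2 \<in> parts 1 k l" "p = stack p1 p2"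
    by blast
  then have "involution p1 \<in> C1 \<inter> parts 1 l k" "involution p2 \<in> C2 \<inter> parts 1 l k"
    using categoryD(6)[OF C1] categoryD(6)[OF C2] involution_parts by auto
  then show ?case using stack_involution *(5) by blast
qed simp

lemma two_level_product_pairings:
  assumes "C1 \<subseteq> pairings 1" "C2 \<subseteq> pairings 1"
  shows "two_level_product C1 C2 \<subseteq> pairings 2"
proof
  fix p assume "p \<in> two_level_product C1 C2"
  then obtain k l p1 p2 where *: "p1 \<in> C1" "p1 \<in> parts 1 k l" "p2 \<in> C2" "p2 \<in> parts 1 k l" "p = stack p1 p2"
    unfolding two_level_product_family family_def by blast
  have card: "card (to_level y ` B) = 2" if "q \<in> parts 1 k l" "q \<in> pairings 1" "B \<in> q" for q B y
    using card_image_block[OF that(1,3) inj_on_to_level, of y] to_level_points that(2,3) by (simp add: pairings_def)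
  have "card B = 2" if "B \<in> p" for B
    using that card[OF *(2)] card[OF *(4)] *(1,3) assms unfolding *(5) stack_def by blast
  then show "p \<in> pairings 2"
    unfolding pairings_family family_def using stack_parts[OF *(2,4)] *(5) by blast
qed

section \<open>Separating the categories\<close>

lemma columns_eval [simp]:
  "columns (Suc 0) X lab x = [lab (X x 1)]"
  "columns 2 X lab x = [lab (X x 1), lab (X x 2)]"
  by (simp_all add: columns_def numeral_2_eq_2)

lemma word_numeral [simp]: "word \<phi> c (numeral n) = word \<phi> c (pred_numeral n) \<circ> \<phi> (c (numeral n))"
  by (simp add: numeral_eq_Suc)

lemma pairingsI: "p \<in> parts m k l \<Longrightarrow> (\<And>B. B \<in> p \<Longrightarrow> card B = 2) \<Longrightarrow> p \<in> pairings m"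
  by (auto simp: pairings_def all_parts_def)

lemma le_2_iff: "Suc 0 \<le> x \<and> x \<le> 2 \<longleftrightarrow> x = 1 \<or> x = 2"
  by auto

lemma le_3_iff: "Suc 0 \<le> x \<and> x \<le> 3 \<longleftrightarrow> x = 1 \<or> x = 2 \<or> x = 3"
  by auto

section \<open>The generators as explicit pairings\<close>

lemma h_part_parts: "h_part m \<in> parts m 3 3"
proof (rule partsI)
  have "\<Union>(h_part m) = (\<Union>y\<in>{1..m}. {Up 1 y, Lo 3 y, Up 2 y, Lo 2 y, Up 3 y, Lo 1 y})"
    unfolding h_part_def by blast
  also have "\<dots> = points m 3 3"
  proof (rule set_eqI)
    fix s show "s \<in> (\<Union>y\<in>{1..m}. {Up 1 y, Lo 3 y, Up 2 y, Lo 2 y, Up 3 y, Lo 1 y}) \<longleftrightarrow> s \<in> points m 3 3"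
      by (cases s) (auto simp: le_3_iff)
  qed
  finally show "\<Union>(h_part m) = points m 3 3" .
qed (auto simp: h_part_def disjoint_def)

lemma chi_part_parts: "chi_part m \<in> parts m 2 2"
proof (rule partsI)
  have "\<Union>(chi_part m) = (\<Union>y\<in>{1..m}. {Up 1 y, Lo 2 y, Up 2 y, Lo 1 y})"
    unfolding chi_part_def by blast
  also have "\<dots> = points m 2 2"
  proof (rule set_eqI)
    fix s show "s \<in> (\<Union>y\<in>{1..m}. {Up 1 y, Lo 2 y, Up 2 y, Lo 1 y}) \<longleftrightarrow> s \<in> points m 2 2"
      by (cases s) (auto simp: le_2_iff)
  qed
  finally show "\<Union>(chi_part m) = points m 2 2" .
qed (auto simp: chi_part_def disjoint_def)

lemma c_part_parts: "c_part \<in> parts 2 1 1"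
proof (rule partsI)
  show "\<Union>c_part = points 2 1 1"
  proof (rule set_eqI)
    fix s show "s \<in> \<Union>c_part \<longleftrightarrow> s \<in> points 2 1 1"
      by (cases s) (auto simp: c_part_def le_2_iff)
  qed
qed (auto simp: c_part_def disjoint_def)

lemma d_part_parts: "d_part \<in> parts 2 1 1"
proof (rule partsI)
  show "\<Union>d_part = points 2 1 1"
  proof (rule set_eqI)
    fix s show "s \<in> \<Union>d_part \<longleftrightarrow> s \<in> points 2 1 1"
      by (cases s) (auto simp: d_part_def le_2_iff)
  qed
qed (auto simp: d_part_def disjoint_def)

lemma a_part_parts: "a_part \<in> parts 2 0 1"
proof (rule partsI)
  show "\<Union>a_part = points 2 0 1"
  proof (rule set_eqI)
    fix s show "s \<in> \<Union>a_part \<longleftrightarrow> s \<in> points 2 0 1"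
      by (cases s) (auto simp: a_part_def le_2_iff)
  qed
qed (auto simp: a_part_def disjoint_def)

lemma parts_pairings:
  "h_part m \<in> pairings m" "chi_part m \<in> pairings m"
  "c_part \<in> pairings 2" "d_part \<in> pairings 2" "a_part \<in> pairings 2"
proof -
  show "h_part m \<in> pairings m" by (rule pairingsI[OF h_part_parts]) (auto simp: h_part_def)
  show "chi_part m \<in> pairings m" by (rule pairingsI[OF chi_part_parts]) (auto simp: chi_part_def)
  show "c_part \<in> pairings 2" by (rule pairingsI[OF c_part_parts]) (auto simp: c_part_def)
  show "d_part \<in> pairings 2" by (rule pairingsI[OF d_part_parts]) (auto simp: d_part_def)
  show "a_part \<in> pairings 2" by (rule pairingsI[OF a_part_parts]) (auto simp: a_part_def)
qed

text \<open>
  The levels of \<open>shear_part\<close> carry different planar pairings in \<open>P(1,3)\<close>, both of which lie in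
  every category because they are tensor products.
\<close>

definition shear_part :: "point set set" where
  "shear_part = stack (tensor 1 1 (id_part 1) (pair_part 1)) (tensor 0 2 (pair_part 1) (id_part 1))"

lemma shear_part_eq:
  "shear_part = {{Up 1 1, Lo 1 1}, {Lo 2 1, Lo 3 1}, {Lo 1 2, Lo 2 2}, {Up 1 2, Lo 3 2}}"
  by (auto simp: shear_part_def stack_def tensor_def id_part_def pair_part_def numeral_3_eq_3 numeral_2_eq_2)

lemma shear_levels_parts:
  "tensor 1 1 (id_part 1) (pair_part 1) \<in> parts 1 1 3"
  "tensor 0 2 (pair_part 1) (id_part 1) \<in> parts 1 1 3"
  using tensor_parts[OF id_part_parts pair_part_parts, of 1] tensor_parts[OF pair_part_parts id_part_parts, of 1]
  by (simp_all add: numeral_3_eq_3)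

lemma shear_part_parts: "shear_part \<in> parts 2 1 3"
  unfolding shear_part_def by (rule stack_parts[OF shear_levels_parts])

lemma labelling_insert: "labelling (insert {s, t} p) lab \<longleftrightarrow> lab s = lab t \<and> labelling p lab"
  by (auto simp: labelling_def)

lemma labelling_empty: "labelling {} lab"
  by (simp add: labelling_def)

lemma h_part_2: "h_part 2 = {{Up 1 1, Lo 3 1}, {Up 2 1, Lo 2 1}, {Up 3 1, Lo 1 1},
    {Up 1 2, Lo 3 2}, {Up 2 2, Lo 2 2}, {Up 3 2, Lo 1 2}}"
proof -
  have "{1..2::nat} = {1, 2}" by auto
  then show ?thesis by (auto simp: h_part_def)
qed

lemma chi_part_2: "chi_part 2 = {{Up 1 1, Lo 2 1}, {Up 2 1, Lo 1 1}, {Up 1 2, Lo 2 2}, {Up 2 2, Lo 1 2}}"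
proof -
  have "{1..2::nat} = {1, 2}" by auto
  then show ?thesis by (auto simp: chi_part_def)
qed

lemma h_part_1: "h_part 1 = {{Up 1 1, Lo 3 1}, {Up 2 1, Lo 2 1}, {Up 3 1, Lo 1 1}}"
  by (simp add: h_part_def)

lemma chi_part_1: "chi_part 1 = {{Up 1 1, Lo 2 1}, {Up 2 1, Lo 1 1}}"
  by (simp add: chi_part_def)

lemmas labelling_parts = h_part_1 [unfolded One_nat_def] h_part_2 chi_part_1 [unfolded One_nat_def] chi_part_2 c_part_def d_part_def a_part_def
  shear_part_eq labelling_insert labelling_empty

section \<open>A separation criterion and its systems of involutions\<close>

fun bilabel :: "(nat \<Rightarrow> nat \<Rightarrow> int) \<Rightarrow> (nat \<Rightarrow> nat \<Rightarrow> int) \<Rightarrow> point \<Rightarrow> int" where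
  "bilabel u v (Up x y) = u x y"
| "bilabel u v (Mid x y) = 0"
| "bilabel u v (Lo x y) = v x y"

text \<open>Each use supplies involutions that balance all of \<open>S\<close>, a colouring of
  \<open>q\<close>, and a value \<open>z\<close> at which the two words differ; evaluating at
  \<open>z\<close> turns an inequality of functions into arithmetic.\<close>

lemma not_in_generated:
  fixes \<phi> :: "'b list \<Rightarrow> 'a \<Rightarrow> 'a"
  assumes "m \<ge> 1" "\<And>c. \<phi> c \<circ> \<phi> c = id" "S \<subseteq> family m (balanced m \<phi>)" "q \<in> parts m k l"
    and "labelling q lab" "word \<phi> (columns m Up lab) k z \<noteq> word \<phi> (columns m Lo lab) l z"
  shows "q \<notin> generated m S"
proof
  assume "q \<in> generated m S"
  moreover have "generated m S \<subseteq> family m (balanced m \<phi>)"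
    by (intro generated_subset category_balanced assms(1-3))
  ultimately have "balanced m \<phi> k l q" using family_iff[OF assms(1,4)] by blast
  then show False using assms(5,6) unfolding balanced_def by metis
qed

text \<open>The word becomes the parity of the number of columns coloured exactly \<open>d\<close>.
  Signs commute, so permutations of columns are invisible; hence \<open>h_part 2\<close> and
  \<open>chi_part 2\<close> are balanced for every \<open>d\<close>.\<close>

definition sign_at :: "int list \<Rightarrow> int list \<Rightarrow> int \<Rightarrow> int" where
  "sign_at d c = (if c = d then uminus else id)"

lemma sign_at_simps:
  "sign_at d c \<circ> sign_at d c = id"
  "sign_at d c z = (if c = d then - z else z)"
  by (auto simp: sign_at_def)

text \<open>Built to be blind to \<open>a_part\<close> and \<open>c_part\<close>: a column with
  equal colours acts trivially, and the sum is symmetric in the two levels. The values still do not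
  commute, so \<open>chi_part 2\<close> is seen.\<close>

definition diagonal_word :: "int list \<Rightarrow> int \<Rightarrow> int" where
  "diagonal_word c = (if c ! 0 = c ! 1 then id else reflection (c ! 0 + c ! 1))"

lemmas in_family_iff = family_iff [OF one_le_numeral h_part_parts] family_iff [OF one_le_numeral chi_part_parts]
  family_iff [OF one_le_numeral c_part_parts] family_iff [OF one_le_numeral d_part_parts]
  family_iff [OF one_le_numeral a_part_parts]

text \<open>\<open>c_part\<close> exchanges the levels, which preserves the symmetric colour
  \<open>[1, 1]\<close>. The columns of \<open>a_part\<close> and \<open>d_part\<close> carry equal
  colours on both levels, so \<open>[0, 1]\<close> never occurs there.\<close>

lemma sign_at_family:
  "h_part 2 \<in> family 2 (balanced 2 (sign_at d))" "chi_part 2 \<in> family 2 (balanced 2 (sign_at d))"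
  "c_part \<in> family 2 (balanced 2 (sign_at [1, 1]))"
  "d_part \<in> family 2 (balanced 2 (sign_at [0, 1]))"
  "a_part \<in> family 2 (balanced 2 (sign_at [0, 1]))"
  unfolding in_family_iff
  by (auto simp: balanced_def labelling_parts fun_eq_iff sign_at_simps)

lemma diagonal_word_family:
  "c_part \<in> family 2 (balanced 2 diagonal_word)" "a_part \<in> family 2 (balanced 2 diagonal_word)"
  unfolding in_family_iff
  by (auto simp: balanced_def labelling_parts diagonal_word_def add.commute)

text \<open>The reflections for \<open>x\<close>, \<open>y\<close>, \<open>z\<close> compose to the
  one for \<open>x - y + z\<close>, which is symmetric in \<open>x\<close> and \<open>z\<close>:
  this is the half-commutation relation encoded by \<open>h_part\<close>.\<close>

lemma reflection_family:
  "h_part 1 \<in> family 1 (balanced 1 (\<lambda>c. reflection (hd c)))"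
  "h_part 2 \<in> family 2 (balanced 2 (\<lambda>c. reflection (hd c)))"
  unfolding in_family_iff family_iff [OF order_refl h_part_parts]
  by (auto simp: balanced_def labelling_parts fun_eq_iff reflection_def)

lemma same_levels_not_in:
  assumes "S \<subseteq> {h_part 2, chi_part 2}"
  shows "a_part \<notin> generated 2 S" "c_part \<notin> generated 2 S" "d_part \<notin> generated 2 S"
    "shear_part \<notin> generated 2 S"
proof -
  have S: "S \<subseteq> family 2 (balanced 2 (sign_at d))" for d
    using assms sign_at_family by blast
  note not_in = not_in_generated[where \<phi> = "sign_at d" for d, OF one_le_numeral sign_at_simps(1) S]
  show "a_part \<notin> generated 2 S"
    by (rule not_in[OF a_part_parts, of "bilabel (\<lambda>_ _. 1) (\<lambda>_ _. 1)" "[1, 1]" 1])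
      (simp_all add: labelling_parts sign_at_simps)
  \<comment> \<open>The upper column reads \<open>[0, 1]\<close> and the lower one
    \<open>[1, 0]\<close>.\<close>
  show "c_part \<notin> generated 2 S"
    by (rule not_in[OF c_part_parts, of "bilabel (\<lambda>_ y. of_nat y - 1) (\<lambda>_ y. 2 - of_nat y)" "[0, 1]" 1])
      (simp_all add: labelling_parts sign_at_simps)
  show "d_part \<notin> generated 2 S"
    by (rule not_in[OF d_part_parts, of "bilabel (\<lambda>_ _. 1) (\<lambda>_ _. 0)" "[1, 1]" 1])
      (simp_all add: labelling_parts sign_at_simps)
  \<comment> \<open>The two through strings start in one upper column and end in the lower columns 1
    and 3, so \<open>[1, 1]\<close> occurs once above and never below.\<close>
  show "shear_part \<notin> generated 2 S"
    by (rule not_in[OF shear_part_parts,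
          of "bilabel (\<lambda>_ _. 1) (\<lambda>x y. if (x = 1 \<and> y = 1) \<or> (x = 3 \<and> y = 2) then 1 else 0)" "[1, 1]" 1])
      (simp_all add: labelling_parts sign_at_simps)
qed

text \<open>With the constant sign \<open>-1\<close>, balance says that \<open>k\<close> and
  \<open>l\<close> have the same parity, which fails for the single column of
  \<open>a_part\<close>.\<close>

lemma a_part_not_in:
  assumes "S \<subseteq> {c_part, d_part}"
  shows "a_part \<notin> generated 2 S"
proof (rule not_in_generated)
  let ?\<phi> = "\<lambda>_ :: int list. uminus :: int \<Rightarrow> int"
  show "?\<phi> c \<circ> ?\<phi> c = id" for c by auto
  have "{c_part, d_part} \<subseteq> family 2 (balanced 2 ?\<phi>)"
    by (simp add: in_family_iff balanced_def)
  then show "S \<subseteq> family 2 (balanced 2 ?\<phi>)" using assms by blast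
  show "word ?\<phi> (columns 2 Up (\<lambda>_. 0)) 0 1 \<noteq> word ?\<phi> (columns 2 Lo (\<lambda>_. 0)) 1 1" by simp
qed (simp_all only: a_part_parts one_le_numeral, simp add: labelling_def)

lemma c_part_not_in:
  assumes "S \<subseteq> {a_part, d_part}"
  shows "c_part \<notin> generated 2 S"
proof (rule not_in_generated)
  let ?lab = "bilabel (\<lambda>_ y. of_nat y - 1) (\<lambda>_ y. 2 - of_nat y)"
  show "S \<subseteq> family 2 (balanced 2 (sign_at [0, 1]))" using assms sign_at_family by blast
  show "word (sign_at [0, 1]) (columns 2 Up ?lab) 1 1 \<noteq> word (sign_at [0, 1]) (columns 2 Lo ?lab) 1 1"
    by (simp add: sign_at_simps)
  show "labelling c_part ?lab" by (simp add: labelling_parts)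
qed (simp_all only: c_part_parts one_le_numeral sign_at_simps(1))

text \<open>\<open>d_part\<close> disconnects its two columns, so one may be coloured
  \<open>[1, 1]\<close> and the other \<open>[0, 0]\<close>; under \<open>c_part\<close> the colour
  \<open>[1, 1]\<close> is passed on unchanged.\<close>

lemma d_part_not_in: "d_part \<notin> generated 2 {c_part}"
proof (rule not_in_generated)
  let ?lab = "bilabel (\<lambda>_ _. 1) (\<lambda>_ _. 0)"
  show "{c_part} \<subseteq> family 2 (balanced 2 (sign_at [1, 1]))" using sign_at_family by blast
  show "word (sign_at [1, 1]) (columns 2 Up ?lab) 1 1 \<noteq> word (sign_at [1, 1]) (columns 2 Lo ?lab) 1 1"
    by (simp add: sign_at_simps)
  show "labelling d_part ?lab" by (simp add: labelling_parts)
qed (simp_all only: d_part_parts one_le_numeral sign_at_simps(1))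

lemma chi_part_not_in_c_a: "chi_part 2 \<notin> generated 2 {c_part, a_part}"
proof (rule not_in_generated)
  \<comment> \<open>Level 1 is constantly 0 and level 2 never is, so no column is silenced; the
    words are the products of the reflections for 1 and 2 in the two orders.\<close>
  let ?lab = "bilabel (\<lambda>x y. if y = 1 then 0 else of_nat x) (\<lambda>x y. if y = 1 then 0 else 3 - of_nat x)"
  show "diagonal_word c \<circ> diagonal_word c = id" for c by (simp add: diagonal_word_def)
  show "{c_part, a_part} \<subseteq> family 2 (balanced 2 diagonal_word)" using diagonal_word_family by blast
  show "word diagonal_word (columns 2 Up ?lab) 2 0 \<noteq> word diagonal_word (columns 2 Lo ?lab) 2 0"
    by (simp add: diagonal_word_def reflection_def)
  show "labelling (chi_part 2) ?lab" by (simp add: labelling_parts)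
qed (simp_all only: chi_part_parts one_le_numeral)

lemma chi_part_not_in_h:
  "S \<subseteq> {h_part 2} \<Longrightarrow> chi_part 2 \<notin> generated 2 S" "chi_part 1 \<notin> generated 1 {h_part 1}"
proof -
  \<comment> \<open>The colours are 1, 2 above and 2, 1 below: the words are translations in
    opposite directions.\<close>
  let ?\<phi> = "\<lambda>c. reflection (hd c)" and ?lab = "bilabel (\<lambda>x _. of_nat x) (\<lambda>x _. 3 - of_nat x)"
  have inv: "?\<phi> c \<circ> ?\<phi> c = id" for c by simp
  have neq: "word ?\<phi> (columns m Up ?lab) 2 0 \<noteq> word ?\<phi> (columns m Lo ?lab) 2 0" if "m = 1 \<or> m = 2" for m
    using that by (auto simp: reflection_def)
  have lab: "labelling (chi_part m) ?lab" for m by (auto simp: chi_part_def labelling_def)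
  show "chi_part 2 \<notin> generated 2 S" if "S \<subseteq> {h_part 2}"
    by (rule not_in_generated[where \<phi> = ?\<phi> and lab = ?lab and z = 0, OF one_le_numeral inv _ chi_part_parts lab neq])
      (use that reflection_family(2) in auto)
  show "chi_part 1 \<notin> generated 1 {h_part 1}"
    by (rule not_in_generated[where \<phi> = ?\<phi> and lab = ?lab and z = 0, OF order_refl inv _ chi_part_parts lab neq])
      (use reflection_family(1) in auto)
qed

lemma h_part_not_in: "h_part 2 \<notin> generated 2 {}"
proof (rule not_in_generated)
  \<comment> \<open>Colour 0 puts the identity in the middle column. Three reflections would
    half-commute and not see \<open>h_part 2\<close>; here the exchange of the outer colours 1 and 3
    is visible.\<close>
  let ?lab = "bilabel (\<lambda>x _. if x = 2 then 0 else of_nat x) (\<lambda>x _. if x = 2 then 0 else 4 - of_nat x)"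
  show "word nc_word (columns 2 Up ?lab) 3 0 \<noteq> word nc_word (columns 2 Lo ?lab) 3 0"
    by (simp add: nc_word_def reflection_def)
  show "labelling (h_part 2) ?lab" by (simp add: labelling_parts)
qed (simp_all only: h_part_parts one_le_numeral nc_word_involutive empty_subsetI)

lemma not_in_nc_pairings: "h_part 1 \<notin> nc_pairings" "chi_part 1 \<notin> nc_pairings"
proof -
  have crossing: "p \<notin> nc_pairings"
    if "{s, s'} \<in> p" "{t, t'} \<in> p" "before s t" "before t s'" "before s' t'" for p s s' t t'
  proof -
    have "{s, s'} \<noteq> {t, t'}" using that(3,4) before_asym by (auto simp: doubleton_eq_iff)
    then have "\<not> noncrossing p" unfolding noncrossing_def using that by (meson insertI1 insertI2)
    then show ?thesis by (simp add: nc_pairings_def)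
  qed
  show "h_part 1 \<notin> nc_pairings"
    by (rule crossing[of "Up 1 1" "Lo 3 1" _ "Up 2 1" "Lo 2 1"]) (auto simp: h_part_def)
  show "chi_part 1 \<notin> nc_pairings"
    by (rule crossing[of "Up 1 1" "Lo 2 1" _ "Up 2 1" "Lo 1 1"]) (auto simp: chi_part_def)
qed

section \<open>Membership in a product\<close>

lemma stack_block_level:
  assumes "B \<in> stack p1 p2"
  obtains y where "\<And>s. s \<in> B \<Longrightarrow> to_level y s = s"
proof -
  obtain y B' where "B = to_level y ` B'" using assms unfolding stack_def by blast
  moreover have "to_level y (to_level y s) = to_level y s" for s by (cases s) auto
  ultimately show ?thesis using that[of y] by auto
qed

text \<open>Blocks of a product stay on one level, while each of these partitions has a block
  meeting both.\<close>

lemma not_in_product: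
  "a_part \<notin> two_level_product C1 C2" "c_part \<notin> two_level_product C1 C2" "d_part \<notin> two_level_product C1 C2"
proof -
  have no: "p \<notin> two_level_product C1 C2" if p: "B \<in> p" "s \<in> B" "t \<in> B"
    "\<And>y. to_level y s = s \<Longrightarrow> to_level y t = t \<Longrightarrow> False" for p B s t
  proof
    assume "p \<in> two_level_product C1 C2"
    then obtain p1 p2 where "p = stack p1 p2" unfolding two_level_product_family family_def by blast
    then obtain y where "\<And>s. s \<in> B \<Longrightarrow> to_level y s = s" using p(1) stack_block_level by metis
    then show False using p by blast
  qed
  show "a_part \<notin> two_level_product C1 C2"
    by (rule no[of "{Lo 1 1, Lo 1 2}" _ "Lo 1 1" "Lo 1 2"]) (auto simp: a_part_def)
  show "c_part \<notin> two_level_product C1 C2"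
    by (rule no[of "{Up 1 1, Lo 1 2}" _ "Up 1 1" "Lo 1 2"]) (auto simp: c_part_def)
  show "d_part \<notin> two_level_product C1 C2"
    by (rule no[of "{Lo 1 1, Lo 1 2}" _ "Lo 1 1" "Lo 1 2"]) (auto simp: d_part_def)
qed

lemma stack_inject:
  assumes "p1 \<in> parts 1 k l" "p2 \<in> parts 1 k l" "q1 \<in> parts 1 k l" "q2 \<in> parts 1 k l"
    and "stack p1 p2 = stack q1 q2"
  shows "p1 = q1" "p2 = q2"
proof -
  have block: "to_level 1 ` B = B" if "p \<in> parts 1 k l" "B \<in> p" for p B
  proof -
    have "to_level 1 s = s" if "s \<in> B" for s
      using that \<open>B \<in> p\<close> partsD[OF \<open>p \<in> parts 1 k l\<close>] to_level_points by blast
    then show ?thesis by (simp cong: image_cong)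
  qed
  then have level_1: "(`) (to_level 1) ` p = p" if p: "p \<in> parts 1 k l" for p
    using that by (simp cong: image_cong)
  have cut: "p = {B \<in> stack p p'. B \<subseteq> range (to_level 1)} \<and>
      (`) (to_level 2) ` p' = {B \<in> stack p p'. \<not> B \<subseteq> range (to_level 1)}"
    if p: "p \<in> parts 1 k l" "p' \<in> parts 1 k l" for p p'
  proof -
    have "B \<subseteq> range (to_level 1)" if "B \<in> p" for B
    proof -
      have "to_level 1 ` B \<subseteq> range (to_level 1)" by blast
      then show ?thesis unfolding block[OF p(1) that] .
    qed
    moreover have "\<not> to_level 2 ` B \<subseteq> range (to_level 1)" if "B \<in> p'" for B
    proof -
      \<comment> \<open>The empty set would lie in the range as well; blocks on level 2 are
        recognised because they contain a point.\<close>
      have "B \<noteq> {}" using that parts_nonempty[OF p(2)] by blast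
      then obtain s where "s \<in> B" by blast
      then show ?thesis using to_level_neq[of _ s] by (metis imageE image_eqI subsetD)
    qed
    ultimately show ?thesis unfolding stack_def level_1[OF p(1)] by blast
  qed
  show "p1 = q1" using cut[OF assms(1,2)] cut[OF assms(3,4)] assms(5) by simp
  have "(`) (to_level 2) ` p2 = (`) (to_level 2) ` q2"
    using cut[OF assms(1,2)] cut[OF assms(3,4)] assms(5) by simp
  then have "(`) (to_level 1) ` (`) (to_level 2) ` p2 = (`) (to_level 1) ` (`) (to_level 2) ` q2" by simp
  moreover have "to_level 1 (to_level 2 s) = to_level 1 s" for s by (cases s) auto
  ultimately have "(`) (to_level 1) ` p2 = (`) (to_level 1) ` q2" by (simp add: image_image)
  then show "p2 = q2" using level_1 assms(2,4) by simp
qed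

lemma stack_in_product_iff:
  assumes "p1 \<in> parts 1 k l" "p2 \<in> parts 1 k l"
  shows "stack p1 p2 \<in> two_level_product C1 C2 \<longleftrightarrow> p1 \<in> C1 \<and> p2 \<in> C2"
proof -
  have "stack p1 p2 \<in> two_level_product C1 C2 \<longleftrightarrow>
      (\<exists>q1 q2. q1 \<in> C1 \<inter> parts 1 k l \<and> q2 \<in> C2 \<inter> parts 1 k l \<and> stack p1 p2 = stack q1 q2)"
    unfolding two_level_product_family by (rule family_iff[OF one_le_numeral stack_parts[OF assms]])
  then show ?thesis using assms stack_inject by blast
qed

lemma factor_properties:
  assumes "C \<in> {nc_pairings, generated 1 {h_part 1}, pairings 1}"
  shows "category 1 C" "C \<subseteq> pairings 1"
proof -
  have "category 1 (generated 1 {h_part 1})"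
    by (rule category_generated) (use h_part_parts in \<open>auto simp: all_parts_def\<close>)
  then show "category 1 C" using assms category_nc_pairings category_pairings[of 1] by auto
  have "generated 1 {h_part 1} \<subseteq> pairings 1"
    by (rule generated_subset) (use category_pairings[of 1] parts_pairings in auto)
  then show "C \<subseteq> pairings 1" using assms by (auto simp: nc_pairings_def)
qed

section \<open>A numerical invariant of the categories\<close>

lemma id_powers:
  assumes "category 1 C"
  defines "i2 \<equiv> tensor 1 1 (id_part 1) (id_part 1)"
  defines "i3 \<equiv> tensor 2 2 i2 (id_part 1)"
  shows "i2 \<in> parts 1 2 2" "i2 \<in> C" "i3 \<in> parts 1 3 3" "i3 \<in> C"
proof -
  note id = categoryD(2)[OF assms(1)] id_part_parts
  show i2: "i2 \<in> parts 1 2 2" "i2 \<in> C"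
    using tensor_parts[OF id(2) id(2)] categoryD(4)[OF assms(1) id id] by (simp_all add: i2_def numeral_2_eq_2)
  show "i3 \<in> parts 1 3 3" "i3 \<in> C"
    using tensor_parts[OF i2(1) id(2)] categoryD(4)[OF assms(1) i2(2,1) id] by (simp_all add: i3_def)
qed

lemma shear_part_in_product:
  assumes C1: "category 1 C1" and C2: "category 1 C2"
  shows "shear_part \<in> two_level_product C1 C2"
proof -
  have "tensor 1 1 (id_part 1) (pair_part 1) \<in> C1"
    using categoryD(4)[OF C1 categoryD(2)[OF C1] id_part_parts categoryD(3)[OF C1] pair_part_parts] .
  moreover have "tensor 0 2 (pair_part 1) (id_part 1) \<in> C2"
    using categoryD(4)[OF C2 categoryD(3)[OF C2] pair_part_parts categoryD(2)[OF C2] id_part_parts] .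
  ultimately show ?thesis
    unfolding shear_part_def by (simp only: stack_in_product_iff[OF shear_levels_parts])
qed

text \<open>The values 0, 1, 2 are meant for \<open>nc_pairings\<close>,
  \<open>generated 1 {h_part 1}\<close> and \<open>pairings 1\<close>. The last contains both
  partitions, so \<open>chi\<close> is tested first.\<close>

definition factor_code :: "bool \<Rightarrow> bool \<Rightarrow> nat" where
  "factor_code h chi = (if chi then 2 else if h then 1 else 0)"

text \<open>The order of the tests keeps the membership questions few: whether \<open>d_part\<close>
  lies in the category of \<open>a_part\<close>, or \<open>h_part 2\<close> in that of
  \<open>chi_part 2\<close>, is never asked. \<open>shear_part\<close> divides the products from the
  categories that treat both levels alike. The factors of a product are tested with an identity on
  the other level and give two base 3 digits, added to 10.\<close>

definition category_code :: "point set set set \<Rightarrow> nat" where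
  "category_code C =
    (let i2 = tensor 1 1 (id_part 1) (id_part 1); i3 = tensor 2 2 i2 (id_part 1)
     in if a_part \<in> C then (if c_part \<in> C then (if chi_part 2 \<in> C then 9 else 8) else 7)
        else if c_part \<in> C then (if d_part \<in> C then 6 else 5)
        else if d_part \<in> C then 4
        else if shear_part \<in> C then
          10 + 3 * factor_code (stack (h_part 1) i3 \<in> C) (stack (chi_part 1) i2 \<in> C)
             + factor_code (stack i3 (h_part 1) \<in> C) (stack i2 (chi_part 1) \<in> C)
        else if chi_part 2 \<in> C then 3
        else if h_part 2 \<in> C then 2
        else 1)"

text \<open>The identities \<open>i2\<close> and \<open>i3\<close> lie in every one-level category,
  so each stacked test depends on a single factor.\<close>

lemma category_code_product:
  assumes C1: "category 1 C1" and C2: "category 1 C2"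
  shows "category_code (two_level_product C1 C2) =
    10 + 3 * factor_code (h_part 1 \<in> C1) (chi_part 1 \<in> C1) + factor_code (h_part 1 \<in> C2) (chi_part 1 \<in> C2)"
  unfolding category_code_def Let_def
  by (simp only: not_in_product shear_part_in_product[OF assms] if_True if_False
      stack_in_product_iff[OF h_part_parts id_powers(3)[OF C2]]
      stack_in_product_iff[OF chi_part_parts id_powers(1)[OF C2]]
      stack_in_product_iff[OF id_powers(3)[OF C2] h_part_parts]
      stack_in_product_iff[OF id_powers(1)[OF C2] chi_part_parts]
      id_powers(2,4)[OF C1] id_powers(2,4)[OF C2] simp_thms)

lemma factor_code_values:
  "factor_code (h_part 1 \<in> nc_pairings) (chi_part 1 \<in> nc_pairings) = 0"
  "factor_code (h_part 1 \<in> generated 1 {h_part 1}) (chi_part 1 \<in> generated 1 {h_part 1}) = 1"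
  "factor_code (h_part 1 \<in> pairings 1) (chi_part 1 \<in> pairings 1) = 2"
  unfolding factor_code_def
  using not_in_nc_pairings chi_part_not_in_h(2) generated_superset[of "{h_part 1}" 1] parts_pairings(1,2)[of 1]
  by (simp_all only: insert_subset if_True if_False)

lemma category_code_generated:
  "category_code (generated 2 {}) = 1"
  "category_code (generated 2 {h_part 2}) = 2"
  "category_code (generated 2 {chi_part 2}) = 3"
  "category_code (generated 2 {d_part}) = 4"
  "category_code (generated 2 {c_part}) = 5"
  "category_code (generated 2 {c_part, d_part}) = 6"
  "category_code (generated 2 {a_part}) = 7"
  "category_code (generated 2 {c_part, a_part}) = 8"
  "category_code (pairings 2) = 9"
proof -
  have mem: "p \<in> generated 2 S" if "p \<in> S" for p S using generated_superset that by blast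
  show "category_code (generated 2 {}) = 1"
    using same_levels_not_in[of "{}"] chi_part_not_in_h(1)[of "{}"] h_part_not_in
    by (simp add: category_code_def)
  show "category_code (generated 2 {h_part 2}) = 2"
    using same_levels_not_in[of "{h_part 2}"] chi_part_not_in_h(1)[of "{h_part 2}"] mem
    by (simp add: category_code_def)
  show "category_code (generated 2 {chi_part 2}) = 3"
    using same_levels_not_in[of "{chi_part 2}"] mem by (simp add: category_code_def)
  show "category_code (generated 2 {d_part}) = 4"
    using a_part_not_in[of "{d_part}"] c_part_not_in[of "{d_part}"] mem by (simp add: category_code_def)
  show "category_code (generated 2 {c_part}) = 5"
    using a_part_not_in[of "{c_part}"] d_part_not_in mem by (simp add: category_code_def)
  show "category_code (generated 2 {c_part, d_part}) = 6"
    using a_part_not_in[of "{c_part, d_part}"] mem by (simp add: category_code_def)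
  show "category_code (generated 2 {a_part}) = 7"
    using c_part_not_in[of "{a_part}"] mem by (simp add: category_code_def)
  show "category_code (generated 2 {c_part, a_part}) = 8"
    using chi_part_not_in_c_a mem by (simp add: category_code_def)
  show "category_code (pairings 2) = 9"
    using parts_pairings by (simp add: category_code_def)
qed

theorem theorem4:
  fixes factors categories :: "point set set set list"
  defines "factors \<equiv> [nc_pairings, generated 1 {h_part 1}, pairings 1]"
  defines "categories \<equiv>
     [generated 2 {},
      generated 2 {h_part 2},
      generated 2 {chi_part 2},
      generated 2 {d_part},
      generated 2 {c_part},
      generated 2 {c_part, d_part},
      generated 2 {a_part},
      generated 2 {c_part, a_part},
      pairings 2]
     @ [two_level_product C1 C2. C1 \<leftarrow> factors, C2 \<leftarrow> factors]"
  shows "(\<forall>C \<in> set categories. category 2 C \<and> C \<subseteq> pairings 2) \<and> distinct categories"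
proof
  have pair2: "category 2 (pairings 2)" by (rule category_pairings) simp
  have gen: "category 2 (generated 2 S) \<and> generated 2 S \<subseteq> pairings 2" if "S \<subseteq> pairings 2" for S
    using that category_generated[of 2 S] generated_subset[OF pair2 that] categoryD(1)[OF pair2] by auto
  have factors: "category 1 C" "C \<subseteq> pairings 1" if "C \<in> set factors" for C
    using that factor_properties[of C] by (simp_all add: factors_def)
  have prod: "category 2 (two_level_product C1 C2) \<and> two_level_product C1 C2 \<subseteq> pairings 2"
    if "C1 \<in> set factors" "C2 \<in> set factors" for C1 C2
    using category_two_level_product[OF factors(1)[OF that(1)] factors(1)[OF that(2)]]
      two_level_product_pairings[OF factors(2)[OF that(1)] factors(2)[OF that(2)]] by blast
  show "\<forall>C \<in> set categories. category 2 C \<and> C \<subseteq> pairings 2"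
    unfolding categories_def set_append ball_Un
  proof (intro conjI ballI)
    fix C assume "C \<in> set [two_level_product C1 C2. C1 \<leftarrow> factors, C2 \<leftarrow> factors]"
    then obtain C1 C2 where "C1 \<in> set factors" "C2 \<in> set factors" "C = two_level_product C1 C2"
      unfolding set_concat set_map image_image by blast
    then show "category 2 C" "C \<subseteq> pairings 2" using prod by blast+
  qed (use gen pair2 parts_pairings in \<open>simp_all only: list.set insert_iff empty_iff, blast+\<close>)
next
  have F: "category 1 nc_pairings" "category 1 (generated 1 {h_part 1})" "category 1 (pairings 1)"
    using factor_properties(1) by blast+
  \<comment> \<open>The list comprehension varies the second factor fastest, in accordance with its
    role as the last base 3 digit.\<close>
  have "map category_code categories = [1, 2, 3, 4, 5, 6, 7, 8, 9, 10, 11, 12, 13, 14, 15, 16, 17, 18]"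
    unfolding categories_def factors_def
    by (simp only: list.map concat.simps append.simps category_code_generated
        category_code_product F factor_code_values) simp
  then have "distinct (map category_code categories)" by simp
  then show "distinct categories" by (simp add: distinct_map)
qed

end
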